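(* Let $\mathbb K$ be a field, $R=\mathbb K[x_1,\dots,x_n]$, let $I=(m_1,\dots,m_q)\subseteq R$ be a monomial ideal and consider the ideal $J=(m_1,\dots,m_{q-1})\subset R$. If $I$ admits a minimal pruned resolution and $m_q=x_1^{a_1}\cdots x_n^{a_n}$ is a monomial such that, for each $i$, either $a_i$ is larger than the degree of $x_i$ in any generator of $J$ or $a_i=0$, then $J$ admits a minimal pruned resolution.
   Context: $m_1,\dots,m_q$ are the minimal monomial generators of $I$. For a monomial ideal with minimal generators in a fixed order $m_1,\dots,m_q$ and $\sigma\subseteq\{1,\dots,q\}$ put $m_\sigma=\mathrm{lcm}(m_i: i\in\sigma)$, $m_\emptyset=1$. The Taylor resolution of $R/I$ is supported on the full simplex $X_{\mathrm{Taylor}}$ on $q$ vertices; the face $\sigma$ has homological degree $|\sigma|$ and multidegree the exponent of $m_\sigma$. Pruning algorithm: for $j=1,\dots,q$ successively (step $j$), for every $\sigma\not\ni j$ with $m_\sigma=m_{\sigma\cup\{j\}}$ and such that neither $\sigma$ nor $\sigma\cup\{j\}$ belongs to a previously selected edge, select (prune) the edge $\{\sigma,\sigma\cup\{j\}\}$. The selected edges form a homogeneous acyclic matching on $X_{\mathrm{Taylor}}$, and discrete Morse theory (Batzies–Welker) yields a $\mathbb Z^n$-graded CW-complex, with cells corresponding to the faces in no selected edge (critical faces), supporting a free resolution of $R/I$: the pruned resolution for the given order. Its module in homological degree $i$ is the direct sum of $R(-\deg m_\sigma)$ over critical $\sigma$ with $|\sigma|=i$; so it is minimal iff, for all $i,\alpha$,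 the number of critical $\sigma$ with $|\sigma|=i$ and multidegree $\alpha$ equals the multigraded Betti number $\beta_{i,\alpha}(R/I)$. A monomial ideal admits a minimal pruned resolution if there is an order of its minimal generators for which the pruned resolution is minimal. *)

theory Defs
  imports
    "HOL-Library.Poly_Mapping"
    "HOL-Library.Function_Algebras"
    "Jordan_Normal_Form.Matrix"
begin

text \<open>
  The variables are indexed by a finite type \<open>'n\<close>.  An exponent vector is a function \<open>'n \<Rightarrow> nat\<close>;
  the order \<open>\<le>\<close> on exponent vectors is pointwise, i.e. divisibility of monomials, and addition is
  pointwise, so that the following type is the polynomial ring with the usual multiplication.
\<close>

type_synonym 'n expo = "'n \<Rightarrow> nat"
type_synonym ('n, 'k) mpol = "('n \<Rightarrow> nat) \<Rightarrow>\<^sub>0 'k"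

definition mon :: "'n expo \<Rightarrow> ('n, 'k::field) mpol" where
  "mon a = Poly_Mapping.single a 1"

definition ideal_gen :: "'r::comm_ring_1 set \<Rightarrow> 'r set" where
  "ideal_gen = module.span (*)"

definition monomial_ideal :: "'n expo set \<Rightarrow> ('n, 'k::field) mpol set" where
  "monomial_ideal A = ideal_gen (mon ` A)"

definition minimal_generators :: "('n, 'k::field) mpol set \<Rightarrow> 'n expo set" where
  "minimal_generators I = {a. mon a \<in> I \<and> (\<forall>b. mon b \<in> I \<longrightarrow> b \<le> a \<longrightarrow> b = a)}"

definition max_ideal :: "('n, 'k::field) mpol set" where
  "max_ideal = ideal_gen (range (\<lambda>j. mon (\<lambda>k. if k = j then 1 else 0)))"

definition multidegree :: "'n expo \<Rightarrow> 'n \<Rightarrow> int" where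
  "multidegree a = (\<lambda>j. int (a j))"

text \<open>The zero polynomial is homogeneous of every degree.\<close>

definition homogeneous :: "('n \<Rightarrow> int) \<Rightarrow> ('n, 'k::field) mpol \<Rightarrow> bool" where
  "homogeneous d p \<longleftrightarrow> (\<forall>a \<in> Poly_Mapping.keys p. multidegree a = d)"

text \<open>
  Multigraded free resolutions of \<open>R/I\<close>, given by homogeneous matrices.  The module in homological
  degree \<open>i\<close> is the free module of rank \<open>r i\<close> whose basis element number \<open>b < r i\<close> has
  multidegree \<open>deg i b\<close>; the matrix \<open>D i\<close> is the differential from homological degree \<open>i + 1\<close> to
  \<open>i\<close>; the augmentation to \<open>R/I\<close> maps basis element number \<open>c\<close> in homological degree \<open>0\<close> to the
  class of \<open>e $ c\<close>.  The last three conditions are exactness at \<open>R/I\<close>, in homological degree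
  \<open>0\<close>, and in all positive homological degrees.
\<close>

definition multigraded_free_resolution ::
  "('n, 'k::field) mpol set \<Rightarrow> (nat \<Rightarrow> nat) \<Rightarrow> (nat \<Rightarrow> nat \<Rightarrow> 'n \<Rightarrow> int) \<Rightarrow>
    (nat \<Rightarrow> ('n, 'k) mpol mat) \<Rightarrow> ('n, 'k) mpol vec \<Rightarrow> bool" where
  "multigraded_free_resolution I r deg D e \<longleftrightarrow>
    (\<forall>i. D i \<in> carrier_mat (r i) (r (Suc i))) \<and>
    e \<in> carrier_vec (r 0) \<and>
    (\<forall>i. \<forall>c < r i. \<forall>b < r (Suc i). homogeneous (deg (Suc i) b - deg i c) (D i $$ (c, b))) \<and>
    (\<forall>c < r 0. homogeneous (deg 0 c) (e $ c)) \<and>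
    (\<forall>f. \<exists>v \<in> carrier_vec (r 0). f - e \<bullet> v \<in> I) \<and>
    (\<forall>v \<in> carrier_vec (r 0). e \<bullet> v \<in> I \<longleftrightarrow> (\<exists>w \<in> carrier_vec (r 1). v = D 0 *\<^sub>v w)) \<and>
    (\<forall>i. \<forall>v \<in> carrier_vec (r (Suc i)).
      D i *\<^sub>v v = 0\<^sub>v (r i) \<longleftrightarrow> (\<exists>w \<in> carrier_vec (r (Suc (Suc i))). v = D (Suc i) *\<^sub>v w))"

definition minimal_multigraded_free_resolution ::
  "('n, 'k::field) mpol set \<Rightarrow> (nat \<Rightarrow> nat) \<Rightarrow> (nat \<Rightarrow> nat \<Rightarrow> 'n \<Rightarrow> int) \<Rightarrow>
    (nat \<Rightarrow> ('n, 'k) mpol mat) \<Rightarrow> ('n, 'k) mpol vec \<Rightarrow> bool" where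
  "minimal_multigraded_free_resolution I r deg D e \<longleftrightarrow>
    multigraded_free_resolution I r deg D e \<and>
    (\<forall>i. \<forall>c < r i. \<forall>b < r (Suc i). D i $$ (c, b) \<in> max_ideal)"

text \<open>
  \<open>multigraded_betti_numbers I \<beta>\<close> says that \<open>\<beta> i \<alpha>\<close> is the multigraded Betti number of \<open>R/I\<close> in
  homological degree \<open>i\<close> and multidegree \<open>\<alpha>\<close>, for all \<open>i\<close> and \<open>\<alpha>\<close>: the number of generators of
  multidegree \<open>\<alpha>\<close> in homological degree \<open>i\<close> of the minimal multigraded free resolution, which is
  unique up to isomorphism.
\<close>

definition multigraded_betti_numbers ::
  "('n, 'k::field) mpol set \<Rightarrow> (nat \<Rightarrow> ('n \<Rightarrow> int) \<Rightarrow> nat) \<Rightarrow> bool" where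
  "multigraded_betti_numbers I \<beta> \<longleftrightarrow>
    (\<exists>r deg D e. minimal_multigraded_free_resolution I r deg D e \<and>
      (\<forall>i \<alpha>. \<beta> i \<alpha> = card {b. b < r i \<and> deg i b = \<alpha>}))"

text \<open>
  A list \<open>ms\<close> of exponent vectors is an ordered system of generators.  Faces of the Taylor simplex
  are sets of positions in \<open>ms\<close>, counted from \<open>0\<close>.
\<close>

definition lcm_face :: "'n expo list \<Rightarrow> nat set \<Rightarrow> 'n expo" where
  "lcm_face ms \<sigma> = (\<lambda>j. Max (insert 0 ((\<lambda>i. (ms ! i) j) ` \<sigma>)))"

text \<open>
  \<open>pruned_edges ms k\<close> contains the edges selected in the first \<open>k\<close> steps.  Distinct edges that
  qualify in the same step are disjoint, so they can be selected simultaneously.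
\<close>

primrec pruned_edges :: "'n expo list \<Rightarrow> nat \<Rightarrow> (nat set \<times> nat set) set" where
  "pruned_edges ms 0 = {}"
| "pruned_edges ms (Suc j) = pruned_edges ms j \<union>
    {(\<sigma>, insert j \<sigma>) | \<sigma>. \<sigma> \<subseteq> {..<length ms} \<and> j \<notin> \<sigma> \<and>
      lcm_face ms \<sigma> = lcm_face ms (insert j \<sigma>) \<and>
      (\<forall>(\<tau>, \<tau>') \<in> pruned_edges ms j. \<sigma> \<notin> {\<tau>, \<tau>'} \<and> insert j \<sigma> \<notin> {\<tau>, \<tau>'})}"

definition critical_faces :: "'n expo list \<Rightarrow> nat set set" where
  "critical_faces ms = {\<sigma>. \<sigma> \<subseteq> {..<length ms} \<and>
    (\<forall>(\<tau>, \<tau>') \<in> pruned_edges ms (length ms). \<sigma> \<notin> {\<tau>, \<tau>'})}"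

definition pruned_rank :: "'n expo list \<Rightarrow> nat \<Rightarrow> ('n \<Rightarrow> int) \<Rightarrow> nat" where
  "pruned_rank ms i \<alpha> =
    card {\<sigma> \<in> critical_faces ms. card \<sigma> = i \<and> multidegree (lcm_face ms \<sigma>) = \<alpha>}"

definition admits_minimal_pruned_resolution :: "('n, 'k::field) mpol set \<Rightarrow> bool" where
  "admits_minimal_pruned_resolution I \<longleftrightarrow>
    (\<exists>ms. distinct ms \<and> set ms = minimal_generators I \<and>
      multigraded_betti_numbers I (pruned_rank ms))"

end

theory Submission imports Defs begin

text \<open>
  If \<open>m q = 0\<close>, then \<open>q = 1\<close> and \<open>J = 0\<close>.  Otherwise fix a variable \<open>i\<close> with \<open>m q i > 0\<close> and put
  \<open>c = m q i\<close>, so that every other generator has degree less than \<open>c\<close> in \<open>x\<^sub>i\<close>.  Order the generators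
  of \<open>J\<close> as in a good order for \<open>I\<close>.  A face of the Taylor simplex has \<open>x\<^sub>i\<close>-degree at least \<open>c\<close>
  exactly if it contains the vertex \<open>q\<close>, so the pruning step of that vertex selects nothing, the other
  steps treat faces with and without \<open>q\<close> separately, and the critical faces for \<open>J\<close> are the critical
  faces for \<open>I\<close> of \<open>x\<^sub>i\<close>-degree less than \<open>c\<close>.  On the algebraic side, the basis elements of
  \<open>x\<^sub>i\<close>-degree less than \<open>c\<close> of a minimal resolution of \<open>R/I\<close> form a minimal resolution of \<open>R/J\<close>:
  in \<open>x\<^sub>i\<close>-degrees \<open>d < c\<close> the two complexes agree, and in degree \<open>d \<ge> c\<close> the restricted complex is
  \<open>x\<^sub>i ^ (d - c + 1)\<close> times its part of degree \<open>c - 1\<close>.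
\<close>

subsection \<open>Monomial ideals and the degree in one variable\<close>

lemma module_times: "Modules.module ((*) :: 'r::comm_ring_1 \<Rightarrow> 'r \<Rightarrow> 'r)"
  by unfold_locales (simp_all add: algebra_simps)

lemma sum_singles:
  fixes p :: "'a \<Rightarrow>\<^sub>0 'b::comm_monoid_add"
  shows "(\<Sum>a\<in>Poly_Mapping.keys p. Poly_Mapping.single a (Poly_Mapping.lookup p a)) = p"
  by (rule poly_mapping_eqI)
    (auto simp: lookup_sum lookup_single when_def in_keys_iff)

text \<open>Every exponent of a multiple of \<open>mon b\<close> is at least b, and conversely a
  single term with exponent a \<ge> b is such a multiple. This turns membership in a monomial ideal
  into a condition on supports.\<close>

lemma mem_monomial_ideal_iff:
  fixes f :: "('n, 'k::field) mpol"
  shows "f \<in> monomial_ideal A \<longleftrightarrow> (\<forall>a\<in>Poly_Mapping.keys f. \<exists>b\<in>A. b \<le> a)"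
proof -
  interpret Modules.module "(*) :: ('n, 'k) mpol \<Rightarrow> ('n, 'k) mpol \<Rightarrow> ('n, 'k) mpol"
    by (rule module_times)
  show ?thesis
  proof
    assume "f \<in> monomial_ideal A"
    then have "f \<in> span (mon ` A)"
      by (simp add: monomial_ideal_def ideal_gen_def)
    then show "\<forall>a\<in>Poly_Mapping.keys f. \<exists>b\<in>A. b \<le> a"
    proof (induction rule: span_induct_alt)
      case base
      show ?case by simp
    next
      case (step c x y)
      then obtain b where b: "b \<in> A" "x = mon b" by auto
      have "\<exists>b\<in>A. b \<le> a" if a: "a \<in> Poly_Mapping.keys (c * x)" for a
      proof -
        obtain u where "a = u + b"
          using a b keys_mult[of c x] by (auto simp: mon_def)
        then have "b \<le> a" by (simp add: le_fun_def)
        then show ?thesis using b(1) by blast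
      qed
      then show ?case
        using step keys_add[of "c * x" y] by blast
    qed
  next
    assume *: "\<forall>a\<in>Poly_Mapping.keys f. \<exists>b\<in>A. b \<le> a"
    have "Poly_Mapping.single a (Poly_Mapping.lookup f a) \<in> span (mon ` A)"
      if "a \<in> Poly_Mapping.keys f" for a
    proof -
      obtain b where b: "b \<in> A" "b \<le> a" using * \<open>a \<in> Poly_Mapping.keys f\<close> by blast
      have "(\<lambda>i. a i - b i) + b = a"
        using b(2) by (auto simp: le_fun_def)
      then have "Poly_Mapping.single a (Poly_Mapping.lookup f a) =
          Poly_Mapping.single (\<lambda>i. a i - b i) (Poly_Mapping.lookup f a) * mon b"
        by (simp add: mon_def mult_single)
      then show ?thesis using b(1) by (auto intro: span_scale span_base)
    qed
    then have "(\<Sum>a\<in>Poly_Mapping.keys f. Poly_Mapping.single a (Poly_Mapping.lookup f a))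
        \<in> span (mon ` A)"
      by (rule span_sum)
    then show "f \<in> monomial_ideal A"
      by (simp add: monomial_ideal_def ideal_gen_def sum_singles)
  qed
qed

text \<open>The exponents of the monomials in the ideal form the upward closure of A, and an upward
  closure has the same minimal elements as A.\<close>

lemma minimal_generators_monomial_ideal:
  "minimal_generators (monomial_ideal A :: ('n, 'k::field) mpol set) =
    {a \<in> A. \<forall>b\<in>A. b \<le> a \<longrightarrow> b = a}"
proof -
  have mem: "(mon a :: ('n, 'k) mpol) \<in> monomial_ideal A \<longleftrightarrow> (\<exists>b\<in>A. b \<le> a)" for a
    by (simp add: mem_monomial_ideal_iff mon_def)
  show ?thesis
    unfolding minimal_generators_def mem by (auto; metis order.refl order.trans)
qed

section \<open>Multiplication by a monomial: cancellation and supports\<close>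

lemma map_key_sum:
  assumes "inj f"
  shows "Poly_Mapping.map_key f (sum g B) = (\<Sum>b\<in>B. Poly_Mapping.map_key f (g b))"
proof -
  have "Poly_Mapping.map_key f 0 = 0" using assms by (intro poly_mapping_eqI) (simp add: map_key.rep_eq)
  then show ?thesis
    by (induction B rule: infinite_finite_induct) (simp_all add: map_key_plus assms)
qed

text \<open>\<open>map_key ((+) a)\<close> moves the coefficient at a + b to b, which undoes the
  shift of exponents caused by the factor; by additivity this is checked on single terms.\<close>

lemma map_key_single_times:
  fixes p :: "('n, 'k::field) mpol"
  shows "Poly_Mapping.map_key ((+) a) (Poly_Mapping.single a 1 * p) = p"
proof -
  have inj: "inj ((+) a)" by (auto simp: inj_def)
  have single: "Poly_Mapping.map_key ((+) a) (Poly_Mapping.single a 1 * Poly_Mapping.single b c)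
      = Poly_Mapping.single b c" for b and c :: 'k
    using map_key_single[OF inj, of b c] by (simp add: mult_single)
  have "Poly_Mapping.map_key ((+) a) (Poly_Mapping.single a 1 *
      (\<Sum>b\<in>Poly_Mapping.keys p. Poly_Mapping.single b (Poly_Mapping.lookup p b))) =
      (\<Sum>b\<in>Poly_Mapping.keys p. Poly_Mapping.single b (Poly_Mapping.lookup p b))"
    by (simp only: sum_distrib_left map_key_sum[OF inj] single)
  then show ?thesis by (simp only: sum_singles)
qed

lemma single_times_left_cancel:
  fixes p p' :: "('n, 'k::field) mpol"
  shows "Poly_Mapping.single a 1 * p = Poly_Mapping.single a 1 * p' \<longleftrightarrow> p = p'"
  by (metis map_key_single_times)

text \<open>\<open>keys_mult\<close> bounds the support from above only; the left inverse
  \<open>map_key ((+) a)\<close> shows that no exponent is lost.\<close>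

lemma keys_single_times:
  fixes p :: "('n, 'k::field) mpol"
  shows "Poly_Mapping.keys (Poly_Mapping.single a 1 * p) = (+) a ` Poly_Mapping.keys p"
proof -
  have inj: "inj ((+) a)" by (auto simp: inj_def)
  have "(+) a -` Poly_Mapping.keys (Poly_Mapping.single a 1 * p) = Poly_Mapping.keys p"
    using keys_map_key[OF inj, of "Poly_Mapping.single a 1 * p"]
    by (simp add: map_key_single_times)
  moreover have "Poly_Mapping.keys (Poly_Mapping.single a 1 * p) \<subseteq> range ((+) a)"
    using keys_mult[of "Poly_Mapping.single a 1" p] by force
  ultimately show ?thesis by blast
qed

definition xpow :: "'n \<Rightarrow> nat \<Rightarrow> ('n, 'k::field) mpol" where
  "xpow i s = Poly_Mapping.single (\<lambda>j. if j = i then s else 0) 1"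

lemma xpow_times_cancel: "xpow i s * p = xpow i s * p' \<longleftrightarrow> p = p'"
  by (simp add: xpow_def single_times_left_cancel)

lemma keys_xpow_times:
  "Poly_Mapping.keys (xpow i s * p) = (\<lambda>a. a(i := a i + s)) ` Poly_Mapping.keys p"
  unfolding xpow_def keys_single_times by (rule image_cong) (auto simp: fun_eq_iff)

text \<open>Divisibility by x_i^s is membership in the monomial ideal with this single generator,
  and the span of one element consists of its multiples.\<close>

lemma xpow_dvd:
  fixes p :: "('n, 'k::field) mpol"
  assumes "\<forall>a\<in>Poly_Mapping.keys p. s \<le> a i"
  shows "\<exists>p'. p = xpow i s * p'"
proof -
  interpret Modules.module "(*) :: ('n, 'k) mpol \<Rightarrow> ('n, 'k) mpol \<Rightarrow> ('n, 'k) mpol"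
    by (rule module_times)
  have "p \<in> monomial_ideal {\<lambda>j. if j = i then s else 0}"
    using assms by (simp add: mem_monomial_ideal_iff le_fun_def)
  then have "p \<in> range (\<lambda>k. k * xpow i s)"
    by (simp add: monomial_ideal_def ideal_gen_def span_singleton mon_def xpow_def)
  then show ?thesis by (auto simp: mult.commute)
qed

text \<open>Degrees are integers because the coefficients of a vector will be asked for degrees
  \<open>d - dg b\<close>, which may be negative; then only 0 qualifies.\<close>

definition pure_degree :: "'n \<Rightarrow> int \<Rightarrow> ('n, 'k::field) mpol \<Rightarrow> bool" where
  "pure_degree i d p \<longleftrightarrow> (\<forall>a\<in>Poly_Mapping.keys p. int (a i) = d)"

definition degree_part :: "'n \<Rightarrow> int \<Rightarrow> ('n, 'k::field) mpol \<Rightarrow> ('n, 'k) mpol" where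
  "degree_part i d p = (\<Sum>a\<in>{a\<in>Poly_Mapping.keys p. int (a i) = d}.
    Poly_Mapping.single a (Poly_Mapping.lookup p a))"

lemma lookup_degree_part:
  "Poly_Mapping.lookup (degree_part i d p) a =
    (if int (a i) = d then Poly_Mapping.lookup p a else 0)"
  by (auto simp: degree_part_def lookup_sum lookup_single when_def in_keys_iff)

lemma keys_degree_part:
  "Poly_Mapping.keys (degree_part i d p) = {a\<in>Poly_Mapping.keys p. int (a i) = d}"
  by (auto simp: in_keys_iff lookup_degree_part split: if_splits)

lemma degree_part_0 [simp]: "degree_part i d 0 = 0"
  by (simp add: degree_part_def)

lemma degree_part_add: "degree_part i d (p + q) = degree_part i d p + degree_part i d q"
  by (rule poly_mapping_eqI) (simp add: lookup_degree_part lookup_add)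

lemma degree_part_diff: "degree_part i d (p - q) = degree_part i d p - degree_part i d q"
  by (rule poly_mapping_eqI) (simp add: lookup_degree_part lookup_minus)

lemma degree_part_sum: "degree_part i d (sum g B) = (\<Sum>b\<in>B. degree_part i d (g b))"
  by (induction B rule: infinite_finite_induct) (simp_all add: degree_part_add)

lemma pure_degree_0 [simp]: "pure_degree i d 0"
  by (simp add: pure_degree_def)

lemma pure_degree_part: "pure_degree i d (degree_part i d p)"
  by (simp add: pure_degree_def keys_degree_part)

lemma degree_part_pure: "pure_degree i d p \<Longrightarrow> degree_part i d p = p"
  by (rule poly_mapping_eqI) (auto simp: lookup_degree_part pure_degree_def in_keys_iff)

lemma degree_part_eq_0:
  "(\<And>a. a \<in> Poly_Mapping.keys p \<Longrightarrow> int (a i) \<noteq> d) \<Longrightarrow> degree_part i d p = 0"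
  by (rule poly_mapping_eqI) (auto simp: lookup_degree_part in_keys_iff)

lemma pure_degree_negative: "pure_degree i d p \<Longrightarrow> d < 0 \<Longrightarrow> p = 0"
  by (metis degree_part_eq_0 degree_part_pure of_nat_0_le_iff pure_degree_def linorder_not_le)

lemma pure_degree_times:
  assumes "pure_degree i d p" "pure_degree i d' q"
  shows "pure_degree i (d + d') (p * q)"
  using keys_mult[of p q] assms by (force simp: pure_degree_def)

lemma pure_degree_xpow_times:
  "pure_degree i d (xpow i s * p) \<longleftrightarrow> pure_degree i (d - int s) p"
  by (auto simp: pure_degree_def keys_xpow_times)

lemma sum_degree_part:
  assumes "finite K" "(\<lambda>a. int (a i)) ` Poly_Mapping.keys p \<subseteq> K"
  shows "(\<Sum>d\<in>K. degree_part i d p) = p"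
proof (rule poly_mapping_eqI)
  fix a
  show "Poly_Mapping.lookup (\<Sum>d\<in>K. degree_part i d p) a = Poly_Mapping.lookup p a"
    using assms by (auto simp: lookup_sum lookup_degree_part in_keys_iff image_subset_iff)
qed

lemma degree_part_times:
  assumes "pure_degree i h p"
  shows "degree_part i d (p * q) = p * degree_part i (d - h) q"
proof -
  \<comment> \<open>The part of q that p carries into degree d is split off; the remainder r
    contributes nothing there.\<close>
  define r where "r = q - degree_part i (d - h) q"
  have r: "int (a i) \<noteq> d - h" if "a \<in> Poly_Mapping.keys r" for a
    using that by (auto simp: r_def in_keys_iff lookup_minus lookup_degree_part)
  have "degree_part i d (p * r) = 0"
    using keys_mult[of p r] assms r by (intro degree_part_eq_0) (force simp: pure_degree_def)
  moreover have "degree_part i d (p * degree_part i (d - h) q) = p * degree_part i (d - h) q"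
    using pure_degree_times[OF assms pure_degree_part[of i "d - h" q]]
    by (intro degree_part_pure) simp
  moreover have "p * q = p * r + p * degree_part i (d - h) q"
    by (simp add: r_def algebra_simps)
  ultimately show ?thesis by (simp add: degree_part_add)
qed

subsection \<open>Restricting an exact sequence to small degrees\<close>

text \<open>
  Elements of a free module are functions supported on the set of basis indices, so that passing to
  a subset of the basis needs no renumbering.
\<close>

definition supported :: "nat set \<Rightarrow> (nat \<Rightarrow> ('n, 'k::field) mpol) set" where
  "supported S = {v. \<forall>b. b \<notin> S \<longrightarrow> v b = 0}"

text \<open>The sum ranges over T only and the result is set to 0 outside S, so the same M can be
  used for smaller index sets.\<close>

definition app :: "nat set \<Rightarrow> nat set \<Rightarrow> (nat \<Rightarrow> nat \<Rightarrow> ('n, 'k::field) mpol) \<Rightarrow>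
    (nat \<Rightarrow> ('n, 'k) mpol) \<Rightarrow> nat \<Rightarrow> ('n, 'k) mpol" where
  "app S T M w = (\<lambda>c. if c \<in> S then \<Sum>b\<in>T. M c b * w b else 0)"

definition scale :: "('n, 'k::field) mpol \<Rightarrow> (nat \<Rightarrow> ('n, 'k) mpol) \<Rightarrow> nat \<Rightarrow> ('n, 'k) mpol" where
  "scale p v = (\<lambda>b. p * v b)"

text \<open>The homogeneous component of degree d in x_i, in the free module whose basis element b
  has degree \<open>dg b\<close>: the coefficient at b then has degree
  \<open>d - dg b\<close>.\<close>

definition vec_part :: "'n \<Rightarrow> (nat \<Rightarrow> int) \<Rightarrow> int \<Rightarrow> (nat \<Rightarrow> ('n, 'k::field) mpol) \<Rightarrow>
    nat \<Rightarrow> ('n, 'k) mpol" where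
  "vec_part i dg d v = (\<lambda>b. degree_part i (d - dg b) (v b))"

definition vec_pure :: "'n \<Rightarrow> (nat \<Rightarrow> int) \<Rightarrow> int \<Rightarrow> (nat \<Rightarrow> ('n, 'k::field) mpol) \<Rightarrow> bool" where
  "vec_pure i dg d v \<longleftrightarrow> (\<forall>b. pure_degree i (d - dg b) (v b))"

definition hom_matrix :: "'n \<Rightarrow> nat set \<Rightarrow> (nat \<Rightarrow> int) \<Rightarrow> nat set \<Rightarrow> (nat \<Rightarrow> int) \<Rightarrow>
    (nat \<Rightarrow> nat \<Rightarrow> ('n, 'k::field) mpol) \<Rightarrow> bool" where
  "hom_matrix i S dg T dg' M \<longleftrightarrow> (\<forall>c\<in>S. \<forall>b\<in>T. pure_degree i (dg' b - dg c) (M c b))"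

lemma supported_0: "0 \<in> supported S"
  by (simp add: supported_def)

lemma supported_add: "u \<in> supported S \<Longrightarrow> v \<in> supported S \<Longrightarrow> u + v \<in> supported S"
  by (simp add: supported_def)

lemma supported_scale: "v \<in> supported S \<Longrightarrow> scale p v \<in> supported S"
  by (simp add: supported_def scale_def)

lemma supported_scale_xpow: "scale (xpow i s) v \<in> supported S \<longleftrightarrow> v \<in> supported S"
proof -
  have "xpow i s * p = 0 \<longleftrightarrow> p = 0" for p :: "('a, 'b) mpol"
    using xpow_times_cancel[of i s p 0] by simp
  then show ?thesis by (simp add: supported_def scale_def)
qed

lemma supported_part: "v \<in> supported S \<Longrightarrow> vec_part i dg d v \<in> supported S"
  by (simp add: supported_def vec_part_def)

lemma supported_app: "app S T M w \<in> supported S"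
  by (simp add: supported_def app_def)

lemma app_0 [simp]: "app S T M 0 = 0"
  by (simp add: app_def fun_eq_iff)

lemma app_add: "app S T M (u + v) = app S T M u + app S T M v"
  by (simp add: app_def fun_eq_iff sum.distrib algebra_simps)

lemma app_scale: "app S T M (scale p v) = scale p (app S T M v)"
  by (simp add: app_def scale_def fun_eq_iff sum_distrib_left algebra_simps)

lemma scale_diff: "scale p (u - v) = scale p u - scale p v"
  by (simp add: scale_def fun_eq_iff algebra_simps)

lemma vec_part_diff: "vec_part i dg d (u - v) = vec_part i dg d u - vec_part i dg d v"
  by (simp add: vec_part_def fun_eq_iff degree_part_diff)

lemma vec_part_0 [simp]: "vec_part i dg d 0 = 0"
  by (simp add: vec_part_def fun_eq_iff)

lemma vec_pure_part: "vec_pure i dg d (vec_part i dg d v)"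
  by (simp add: vec_pure_def vec_part_def pure_degree_part)

lemma vec_part_pure: "vec_pure i dg d v \<Longrightarrow> vec_part i dg d v = v"
  by (simp add: vec_pure_def vec_part_def degree_part_pure fun_eq_iff)

lemma vec_pure_diff:
  assumes "vec_pure i dg d u" "vec_pure i dg d v"
  shows "vec_pure i dg d (u - v)"
  by (metis assms vec_part_diff vec_part_pure vec_pure_part)

text \<open>The entry at (c, b) has degree \<open>dg' b - dg c\<close>, so degree
  \<open>d - dg c\<close> of the product comes exactly from degree \<open>d - dg' b\<close> of the
  coefficient at b.\<close>

lemma app_part:
  assumes "hom_matrix i S dg T dg' M"
  shows "vec_part i dg d (app S T M w) = app S T M (vec_part i dg' d w)"
proof
  fix c
  have "degree_part i (d - dg c) (M c b * w b) = M c b * degree_part i (d - dg' b) (w b)"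
    if "c \<in> S" "b \<in> T" for b
    using degree_part_times[of i "dg' b - dg c" "M c b" "d - dg c" "w b"] assms that
    by (simp add: hom_matrix_def)
  then show "vec_part i dg d (app S T M w) c = app S T M (vec_part i dg' d w) c"
    by (simp add: vec_part_def app_def degree_part_sum)
qed

lemma app_pure:
  assumes "hom_matrix i S dg T dg' M" "vec_pure i dg' d w"
  shows "vec_pure i dg d (app S T M w)"
  using vec_pure_part[of i dg d "app S T M w"]
  by (simp only: app_part[OF assms(1)] vec_part_pure[OF assms(2)])

text \<open>An element of a free module of finite rank is the sum of finitely many homogeneous
  components, so a property closed under sums need only be verified on these.\<close>

lemma parts_induct:
  assumes "finite S" "v \<in> supported S"
    and zero: "P 0" and add: "\<And>u w. P u \<Longrightarrow> P w \<Longrightarrow> P (u + w)"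
    and part: "\<And>d. P (vec_part i dg d v)"
  shows "P v"
proof -
  define K where "K = (\<Union>b\<in>S. (\<lambda>a. int (a i) + dg b) ` Poly_Mapping.keys (v b))"
  have K: "finite K" using assms(1) by (simp add: K_def)
  have "P (\<Sum>d\<in>L. vec_part i dg d v)" if "finite L" for L
    using that by (induction L) (simp_all only: sum.empty sum.insert zero add part not_False_eq_True)
  moreover have "(\<Sum>d\<in>K. vec_part i dg d v) = v"
  proof
    fix b
    have sum_apply: "(\<Sum>d\<in>L. vec_part i dg d v) b = (\<Sum>d\<in>L. vec_part i dg d v b)" for L
      by (induction L rule: infinite_finite_induct) simp_all
    show "(\<Sum>d\<in>K. vec_part i dg d v) b = v b"
    proof (cases "b \<in> S")
      case True
      have "(\<Sum>d\<in>K. degree_part i (d - dg b) (v b)) =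
          (\<Sum>d\<in>(\<lambda>d. d - dg b) ` K. degree_part i d (v b))"
        by (subst sum.reindex) (auto simp: inj_on_def)
      also have "\<dots> = v b"
        using True K by (intro sum_degree_part) (force simp: K_def)+
      finally show ?thesis by (simp only: sum_apply) (simp add: vec_part_def)
    next
      case False
      then show ?thesis using assms(2) by (simp only: sum_apply) (simp add: vec_part_def supported_def)
    qed
  qed
  ultimately show ?thesis using K by metis
qed

section \<open>Truncation to basis elements of degree less than c\<close>

definition below :: "(nat \<Rightarrow> int) \<Rightarrow> int \<Rightarrow> nat set \<Rightarrow> nat set" where
  "below dg c S = {b \<in> S. dg b < c}"

text \<open>A coefficient at a basis element of degree at least c would have negative
  degree.\<close>

lemma pure_supported_below:
  assumes "vec_pure i dg d v" "d < c"
  shows "v \<in> supported (below dg c S) \<longleftrightarrow> v \<in> supported S"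
proof -
  have "v b = 0" if "\<not> dg b < c" for b
    using pure_degree_negative[of i "d - dg b" "v b"] assms that by (simp add: vec_pure_def)
  then show ?thesis by (auto simp: supported_def below_def)
qed

lemma supported_below_subset: "v \<in> supported (below dg c S) \<Longrightarrow> v \<in> supported S"
  by (simp add: supported_def below_def)

text \<open>An entry from a column of degree less than c to a row of degree at least c has negative
  degree and vanishes, so truncated vectors are mapped to truncated vectors by the same
  matrix.\<close>

lemma app_below:
  assumes "hom_matrix i S dg T dg' M" "w \<in> supported (below dg' c T)" "finite T"
  shows "app (below dg c S) (below dg' c T) M w = app S T M w"
proof
  fix a
  have *: "(\<Sum>b\<in>below dg' c T. M a b * w b) = (\<Sum>b\<in>T. M a b * w b)"
    using assms(2,3) by (intro sum.mono_neutral_left) (auto simp: below_def supported_def)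
  have "M a b * w b = 0" if "a \<in> S" "\<not> dg a < c" "b \<in> T" for b
  proof (cases "dg' b < c")
    case True
    then have "M a b = 0"
      using assms(1) that by (intro pure_degree_negative[of i "dg' b - dg a"]) (auto simp: hom_matrix_def)
    then show ?thesis by simp
  next
    case False
    then show ?thesis using assms(2) by (simp add: supported_def below_def)
  qed
  then show "app (below dg c S) (below dg' c T) M w a = app S T M w a"
    unfolding app_def * by (auto simp: below_def)
qed

text \<open>A surviving basis element has degree at most c - 1, so its coefficient in v has degree
  at least d - c + 1 in x_i and is divisible by that power.\<close>

lemma pure_divide:
  assumes "vec_pure i dg d v" "c \<le> d" "v \<in> supported (below dg c S)"
  obtains u where "u \<in> supported (below dg c S)" "vec_pure i dg (c - 1) u"
    "v = scale (xpow i (nat (d - c + 1))) u"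
proof -
  let ?s = "nat (d - c + 1)"
  have "\<exists>p. v b = xpow i ?s * p" for b
  proof (cases "b \<in> below dg c S")
    case True
    have "?s \<le> a i" if "a \<in> Poly_Mapping.keys (v b)" for a
    proof -
      have "int (a i) = d - dg b"
        using assms(1) that by (simp add: vec_pure_def pure_degree_def)
      moreover have "dg b < c" using True by (simp add: below_def)
      ultimately show ?thesis by linarith
    qed
    then show ?thesis by (intro xpow_dvd) blast
  next
    case False
    then show ?thesis using assms(3) by (intro exI[of _ 0]) (simp add: supported_def)
  qed
  then obtain u where u: "\<And>b. v b = xpow i ?s * u b" by metis
  then have v: "v = scale (xpow i ?s) u" by (simp add: scale_def fun_eq_iff)
  have "pure_degree i (d - dg b - int ?s) (u b)" for b
    using assms(1) u[of b] by (metis pure_degree_xpow_times vec_pure_def)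
  moreover have s: "d - dg b - int ?s = c - 1 - dg b" for b
    using assms(2) by simp
  ultimately have "vec_pure i dg (c - 1) u" unfolding vec_pure_def s by blast
  moreover have "u \<in> supported (below dg c S)"
    using assms(3) by (simp add: v supported_scale_xpow)
  ultimately show thesis using v that by blast
qed

text \<open>
  \<open>N\<close> and \<open>N'\<close> agree in degrees less than \<open>c\<close>, and \<open>N'\<close> is determined by its part of degree \<open>c - 1\<close>
  from there on.  The pairs \<open>(I, J)\<close> and \<open>(0, 0)\<close> have this property, which passes to preimages under
  the differentials; this treats exactness at \<open>R/I\<close>, in degree \<open>0\<close> and in positive degrees alike.
\<close>

definition compatible :: "'n \<Rightarrow> int \<Rightarrow> (nat \<Rightarrow> int) \<Rightarrow> (nat \<Rightarrow> ('n, 'k::field) mpol) set \<Rightarrow>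
    (nat \<Rightarrow> ('n, 'k) mpol) set \<Rightarrow> bool" where
  "compatible i c dg N N' \<longleftrightarrow>
    0 \<in> N' \<and> (\<forall>u\<in>N'. \<forall>v\<in>N'. u + v \<in> N') \<and> (\<forall>v\<in>N'. \<forall>s. scale (xpow i s) v \<in> N') \<and>
    (\<forall>v\<in>N. \<forall>d. vec_part i dg d v \<in> N) \<and> (\<forall>v\<in>N'. \<forall>d. vec_part i dg d v \<in> N') \<and>
    (\<forall>d<c. \<forall>v. vec_pure i dg d v \<longrightarrow> (v \<in> N \<longleftrightarrow> v \<in> N')) \<and>
    (\<forall>v s. vec_pure i dg (c - 1) v \<longrightarrow> scale (xpow i s) v \<in> N' \<longrightarrow> v \<in> N')"

lemma compatibleD:
  assumes "compatible i c dg N N'"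
  shows "0 \<in> N'"
    and "u \<in> N' \<Longrightarrow> v \<in> N' \<Longrightarrow> u + v \<in> N'"
    and "v \<in> N' \<Longrightarrow> scale (xpow i s) v \<in> N'"
    and "v \<in> N \<Longrightarrow> vec_part i dg d v \<in> N"
    and "v \<in> N' \<Longrightarrow> vec_part i dg d v \<in> N'"
    and "d < c \<Longrightarrow> vec_pure i dg d v \<Longrightarrow> v \<in> N \<longleftrightarrow> v \<in> N'"
    and "vec_pure i dg (c - 1) v \<Longrightarrow> scale (xpow i s) v \<in> N' \<Longrightarrow> v \<in> N'"
  using assms unfolding compatible_def by blast+

text \<open>Multiplication by x_i^s is injective. With this pair, preimages become kernels and
  membership of a difference in N becomes an equation.\<close>

lemma compatible_zero: "compatible i c dg {0} {0}"
proof -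
  have "scale (xpow i s) v = 0 \<longleftrightarrow> v = 0" for s and v :: "nat \<Rightarrow> ('a, 'b) mpol"
    using supported_scale_xpow[of i s v "{}"] by (auto simp: supported_def fun_eq_iff)
  then show ?thesis by (auto simp: compatible_def)
qed

text \<open>With this pair in the place of the kernels, exactness at R/I says that the augmentation
  is surjective.\<close>

lemma compatible_UNIV: "compatible i c dg UNIV UNIV"
  by (simp add: compatible_def)

text \<open>The ring is viewed as the free module on the basis element 0 of degree 0. By
  \<open>eq\<close> the ideals contain the same monomials of degree less than c. By
  \<open>bound\<close> no generator of J exceeds c - 1 in x_i, so raising an exponent beyond c - 1
  does not affect membership in J.\<close>

lemma compatible_ideal:
  fixes I J :: "('n, 'k::field) mpol set"
  assumes I: "I = monomial_ideal G" and J: "J = monomial_ideal H"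
    and eq: "\<And>a. int (a i) < c \<Longrightarrow> (\<exists>b\<in>G. b \<le> a) \<longleftrightarrow> (\<exists>b\<in>H. b \<le> a)"
    and bound: "\<And>b. b \<in> H \<Longrightarrow> int (b i) < c"
  shows "compatible i c (\<lambda>_. 0) {v. v 0 \<in> I} {v. v 0 \<in> J}"
  unfolding compatible_def
proof (intro conjI)
  show "0 \<in> {v. v 0 \<in> J}"
    by (simp add: J mem_monomial_ideal_iff)
  show "\<forall>u\<in>{v. v 0 \<in> J}. \<forall>v\<in>{v. v 0 \<in> J}. u + v \<in> {v. v 0 \<in> J}"
    using keys_add by (fastforce simp: J mem_monomial_ideal_iff)
  have le: "b \<le> a(i := a i + s)" if "b \<le> a" for a b :: "'n \<Rightarrow> nat" and s
    using that by (simp add: le_fun_def trans_le_add1)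
  show "\<forall>v\<in>{v. v 0 \<in> J}. \<forall>s. scale (xpow i s) v \<in> {v. v 0 \<in> J}"
    by (auto simp: J mem_monomial_ideal_iff scale_def keys_xpow_times) (metis le)
  show "\<forall>v\<in>{v. v 0 \<in> I}. \<forall>d. vec_part i (\<lambda>_. 0) d v \<in> {v. v 0 \<in> I}"
    "\<forall>v\<in>{v. v 0 \<in> J}. \<forall>d. vec_part i (\<lambda>_. 0) d v \<in> {v. v 0 \<in> J}"
    by (auto simp: I J mem_monomial_ideal_iff vec_part_def keys_degree_part)
  show "\<forall>d<c. \<forall>v. vec_pure i (\<lambda>_. 0) d v \<longrightarrow> (v \<in> {v. v 0 \<in> I}) = (v \<in> {v. v 0 \<in> J})"
  proof (intro allI impI)
    fix d and v :: "nat \<Rightarrow> ('n, 'k) mpol"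
    assume "d < c" "vec_pure i (\<lambda>_. 0) d v"
    then have "int (a i) < c" if "a \<in> Poly_Mapping.keys (v 0)" for a
      using that by (auto simp: vec_pure_def pure_degree_def)
    then show "(v \<in> {v. v 0 \<in> I}) = (v \<in> {v. v 0 \<in> J})"
      using eq by (simp add: I J mem_monomial_ideal_iff)
  qed
  show "\<forall>v s. vec_pure i (\<lambda>_. 0) (c - 1) v \<longrightarrow> scale (xpow i s) v \<in> {v. v 0 \<in> J} \<longrightarrow>
      v \<in> {v. v 0 \<in> J}"
  proof (intro allI impI)
    fix v :: "nat \<Rightarrow> ('n, 'k) mpol" and s
    assume pure: "vec_pure i (\<lambda>_. 0) (c - 1) v" and "scale (xpow i s) v \<in> {v. v 0 \<in> J}"
    then have ex: "\<exists>b\<in>H. b \<le> a(i := a i + s)" if "a \<in> Poly_Mapping.keys (v 0)" for a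
      using that by (simp add: J mem_monomial_ideal_iff scale_def keys_xpow_times)
    have "\<exists>b\<in>H. b \<le> a" if a: "a \<in> Poly_Mapping.keys (v 0)" for a
    proof -
      obtain b where b: "b \<in> H" "b \<le> a(i := a i + s)" using ex[OF a] by blast
      have "int (a i) = c - 1"
        using pure a by (auto simp: vec_pure_def pure_degree_def)
      then have "b i \<le> a i" using bound[OF b(1)] by linarith
      then have "b \<le> a" using b(2) by (auto simp: le_fun_def split: if_splits)
      then show ?thesis using b(1) by blast
    qed
    then show "v \<in> {v. v 0 \<in> J}"
      by (simp add: J mem_monomial_ideal_iff)
  qed
qed

text \<open>\<open>app\<close> commutes with homogeneous components and with multiplication by
  x_i^s, so the conditions pull back; \<open>pure_supported_below\<close> matches the two support
  conditions in degrees less than c.\<close>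

lemma compatible_vimage:
  assumes hom: "hom_matrix i S dg T dg' M" and N: "compatible i c dg N N'"
  shows "compatible i c dg' {v \<in> supported T. app S T M v \<in> N}
    {v \<in> supported (below dg' c T). app S T M v \<in> N'}" (is "compatible i c dg' ?K ?K'")
  unfolding compatible_def
proof (intro conjI allI ballI impI)
  show "0 \<in> ?K'"
    using compatibleD(1)[OF N] supported_0 by simp
  show "u + v \<in> ?K'" if "u \<in> ?K'" "v \<in> ?K'" for u v
    using that compatibleD(2)[OF N] supported_add unfolding mem_Collect_eq app_add by blast
  show "scale (xpow i s) v \<in> ?K'" if "v \<in> ?K'" for s v
    using that compatibleD(3)[OF N] supported_scale unfolding mem_Collect_eq app_scale by blast
  show "vec_part i dg' d v \<in> ?K" if "v \<in> ?K" for d v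
    using that compatibleD(4)[OF N, of "app S T M v" d] supported_part[of v T i dg' d]
    by (simp add: app_part[OF hom])
  show "vec_part i dg' d v \<in> ?K'" if "v \<in> ?K'" for d v
    using that compatibleD(5)[OF N, of "app S T M v" d] supported_part[of v _ i dg' d]
    by (simp add: app_part[OF hom])
  show "v \<in> ?K \<longleftrightarrow> v \<in> ?K'" if "d < c" "vec_pure i dg' d v" for d v
    using compatibleD(6)[OF N that(1) app_pure[OF hom that(2)]]
      pure_supported_below[OF that(2,1)] by blast
  show "v \<in> ?K'" if "vec_pure i dg' (c - 1) v" "scale (xpow i s) v \<in> ?K'" for v s
    using that(2) compatibleD(7)[OF N app_pure[OF hom that(1)]]
    unfolding mem_Collect_eq app_scale supported_scale_xpow by blast
qed

text \<open>K is the kernel, and the image is taken modulo N. In degree d < c both sequences agree.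
  In degree d \<ge> c one divides by x_i^(d - c + 1), argues in degree c - 1 and multiplies back.
  The conclusion has the full map \<open>app S T M\<close>, which by \<open>app_below\<close> agrees
  with the truncated one on truncated vectors.\<close>

lemma exact_below:
  assumes fin: "finite S" and hom: "hom_matrix i S dg T dg' M"
    and K: "compatible i c dg K K'" and N: "compatible i c dg N N'"
    and exact: "\<And>v. v \<in> supported S \<Longrightarrow>
      v \<in> K \<longleftrightarrow> (\<exists>w\<in>supported T. v - app S T M w \<in> N)"
    and v: "v \<in> supported (below dg c S)"
  shows "v \<in> K' \<longleftrightarrow> (\<exists>w\<in>supported (below dg' c T). v - app S T M w \<in> N')"
proof
  have fin': "finite (below dg c S)" using fin by (simp add: below_def)
  note K_0 = compatibleD(1)[OF K] and K_add = compatibleD(2)[OF K]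
    and K_scale = compatibleD(3)[OF K] and K_part = compatibleD(5)[OF K]
    and K_pure = compatibleD(6)[OF K] and K_sat = compatibleD(7)[OF K]
  note N_0 = compatibleD(1)[OF N] and N_add = compatibleD(2)[OF N]
    and N_scale = compatibleD(3)[OF N] and N_part = compatibleD(4,5)[OF N]
    and N_pure = compatibleD(6)[OF N] and N_sat = compatibleD(7)[OF N]
  {
    assume "v \<in> K'"
    define P where "P u \<longleftrightarrow> (\<exists>w\<in>supported (below dg' c T). u - app S T M w \<in> N')" for u
    have low: "P u" if u: "u \<in> supported (below dg c S)" "u \<in> K'" "vec_pure i dg d u" "d < c" for u d
    proof -
      have "u \<in> K" using u K_pure by blast
      then obtain w where w: "w \<in> supported T" "u - app S T M w \<in> N"
        using exact supported_below_subset u(1) by blast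
      \<comment> \<open>The preimage w of u modulo N need not be homogeneous, but u is, so the
        component of w in degree d will do; as d < c, it involves surviving basis elements
        only.\<close>
      have "vec_part i dg d (u - app S T M w) \<in> N" using w N_part by blast
      then have "u - app S T M (vec_part i dg' d w) \<in> N"
        using u(3) by (simp add: vec_part_diff app_part[OF hom] vec_part_pure)
      moreover have "vec_pure i dg d (u - app S T M (vec_part i dg' d w))"
        using u(3) app_pure[OF hom vec_pure_part] by (rule vec_pure_diff)
      ultimately have "u - app S T M (vec_part i dg' d w) \<in> N'"
        using N_pure u(4) by blast
      moreover have "vec_part i dg' d w \<in> supported (below dg' c T)"
        using pure_supported_below[OF vec_pure_part[of i dg' d w] u(4)] supported_part[OF w(1)]
        by blast
      ultimately show "P u" unfolding P_def by blast
    qed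
    have "P v"
    proof (rule parts_induct[where P = P, OF fin' v, of i dg])
      have "0 - app S T M 0 = 0" by (simp only: app_0 diff_self)
      then show "P 0" unfolding P_def using N_0 supported_0 by metis
    next
      fix u u' assume "P u" "P u'"
      then obtain w w' where w: "w \<in> supported (below dg' c T)" "u - app S T M w \<in> N'"
        "w' \<in> supported (below dg' c T)" "u' - app S T M w' \<in> N'"
        unfolding P_def by blast
      have "(u - app S T M w) + (u' - app S T M w') = (u + u') - app S T M (w + w')"
        by (simp only: app_add add_diff_add)
      then have "(u + u') - app S T M (w + w') \<in> N'"
        using N_add[OF w(2,4)] by (simp only:)
      then show "P (u + u')"
        unfolding P_def using supported_add[OF w(1,3)] by (rule bexI)
    next
      fix d
      let ?u = "vec_part i dg d v"
      have u: "?u \<in> supported (below dg c S)" "?u \<in> K'" "vec_pure i dg d ?u"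
        using supported_part[OF v] K_part[OF \<open>v \<in> K'\<close>] vec_pure_part by auto
      show "P ?u"
      proof (cases "d < c")
        case True
        then show ?thesis using low u by blast
      next
        case False
        then have "c \<le> d" by simp
        \<comment> \<open>The quotient \<open>u'\<close> has degree c - 1, where both sequences
          still agree, and it lies in \<open>K'\<close> because powers of x_i can be cancelled from
          membership in that degree.\<close>
        obtain u' where u': "u' \<in> supported (below dg c S)" "vec_pure i dg (c - 1) u'"
          "?u = scale (xpow i (nat (d - c + 1))) u'"
          using pure_divide[OF u(3) \<open>c \<le> d\<close> u(1)] .
        have "u' \<in> K'" using K_sat[OF u'(2)] u(2) unfolding u'(3) .
        then have "P u'" using low[OF u'(1) _ u'(2)] by simp
        then obtain w where w: "w \<in> supported (below dg' c T)" "u' - app S T M w \<in> N'"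
          unfolding P_def by blast
        have "?u - app S T M (scale (xpow i (nat (d - c + 1))) w) \<in> N'"
          using N_scale[OF w(2), of "nat (d - c + 1)"] by (simp only: u'(3) app_scale scale_diff)
        then show ?thesis
          unfolding P_def using supported_scale[OF w(1)] by (rule bexI)
      qed
    qed
    then show "\<exists>w\<in>supported (below dg' c T). v - app S T M w \<in> N'" by (simp add: P_def)
  }
  {
    assume "\<exists>w\<in>supported (below dg' c T). v - app S T M w \<in> N'"
    then obtain w where w: "w \<in> supported (below dg' c T)" "v - app S T M w \<in> N'" by blast
    have low: "u \<in> K'" if u: "u \<in> supported (below dg c S)" and z: "z \<in> supported (below dg' c T)"
      and pure: "vec_pure i dg d u" "vec_pure i dg' d z" and d: "d < c"
      and N': "u - app S T M z \<in> N'" for u z d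
    proof -
      have "vec_pure i dg d (u - app S T M z)"
        using vec_pure_diff[OF pure(1) app_pure[OF hom pure(2)]] .
      then have "u - app S T M z \<in> N" using N_pure[OF d] N' by blast
      then have "u \<in> K"
        using exact[OF supported_below_subset[OF u]] supported_below_subset[OF z] by blast
      then show ?thesis using K_pure[OF d pure(1)] by blast
    qed
    show "v \<in> K'"
    proof (rule parts_induct[where P = "\<lambda>u. u \<in> K'", OF fin' v, of i dg])
      fix d
      let ?u = "vec_part i dg d v" and ?z = "vec_part i dg' d w"
      note u = supported_part[OF v, of i dg d] supported_part[OF w(1), of i dg' d]
        vec_pure_part[of i dg d v] vec_pure_part[of i dg' d w]
      have N': "?u - app S T M ?z \<in> N'"
        using N_part(2)[OF w(2), of d] by (simp add: vec_part_diff app_part[OF hom])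
      show "?u \<in> K'"
      proof (cases "d < c")
        case True
        then show ?thesis using low[OF u _ N'] by blast
      next
        case False
        then have "c \<le> d" by simp
        obtain u' where u': "u' \<in> supported (below dg c S)" "vec_pure i dg (c - 1) u'"
          "?u = scale (xpow i (nat (d - c + 1))) u'"
          using pure_divide[OF u(3) \<open>c \<le> d\<close> u(1)] .
        obtain z' where z': "z' \<in> supported (below dg' c T)" "vec_pure i dg' (c - 1) z'"
          "?z = scale (xpow i (nat (d - c + 1))) z'"
          using pure_divide[OF u(4) \<open>c \<le> d\<close> u(2)] .
        \<comment> \<open>Both \<open>?u\<close> and \<open>?z\<close> have degree d, hence the same
          power of x_i was split off, and it cancels modulo \<open>N'\<close> in degree c -
          1.\<close>
        have "scale (xpow i (nat (d - c + 1))) (u' - app S T M z') \<in> N'"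
          using N' by (simp add: u'(3) z'(3) app_scale scale_diff)
        then have "u' - app S T M z' \<in> N'"
          using N_sat[OF vec_pure_diff[OF u'(2) app_pure[OF hom z'(2)]]] by blast
        then have "u' \<in> K'" using low[OF u'(1) z'(1) u'(2) z'(2)] by simp
        then show ?thesis using K_scale u'(3) by simp
      qed
    qed (use K_0 K_add in auto)
  }
qed

subsection \<open>Restricting a free resolution\<close>

text \<open>This is \<open>multigraded_free_resolution\<close> with index sets \<open>S j\<close>
  instead of ranks, so that truncation merely shrinks the sets and keeps dg, M and E.\<close>

definition indexed_resolution :: "('n, 'k::field) mpol set \<Rightarrow> (nat \<Rightarrow> nat set) \<Rightarrow>
    (nat \<Rightarrow> nat \<Rightarrow> 'n \<Rightarrow> int) \<Rightarrow> (nat \<Rightarrow> nat \<Rightarrow> nat \<Rightarrow> ('n, 'k) mpol) \<Rightarrow>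
    (nat \<Rightarrow> ('n, 'k) mpol) \<Rightarrow> bool" where
  "indexed_resolution I S dg M E \<longleftrightarrow>
    (\<forall>j. \<forall>c\<in>S j. \<forall>b\<in>S (Suc j). homogeneous (dg (Suc j) b - dg j c) (M j c b)) \<and>
    (\<forall>c\<in>S 0. homogeneous (dg 0 c) (E c)) \<and>
    (\<forall>f. \<exists>v\<in>supported (S 0). f - (\<Sum>b\<in>S 0. E b * v b) \<in> I) \<and>
    (\<forall>v\<in>supported (S 0). (\<Sum>b\<in>S 0. E b * v b) \<in> I \<longleftrightarrow>
      (\<exists>w\<in>supported (S 1). v = app (S 0) (S 1) (M 0) w)) \<and>
    (\<forall>j. \<forall>v\<in>supported (S (Suc j)). app (S j) (S (Suc j)) (M j) v = 0 \<longleftrightarrow>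
      (\<exists>w\<in>supported (S (Suc (Suc j))). v = app (S (Suc j)) (S (Suc (Suc j))) (M (Suc j)) w))"

section \<open>Passing between index sets and column vectors\<close>

definition enum_vec :: "nat \<Rightarrow> (nat \<Rightarrow> nat) \<Rightarrow> (nat \<Rightarrow> ('n, 'k::field) mpol) \<Rightarrow> ('n, 'k) mpol vec" where
  "enum_vec n h v = vec n (\<lambda>b. v (h b))"

lemma enum_vec_supported:
  assumes "bij_betw h {..<n} S"
  shows "enum_vec n h ` supported S = (carrier_vec n :: ('n, 'k::field) mpol vec set)"
proof
  show "enum_vec n h ` supported S \<subseteq> (carrier_vec n :: ('n, 'k) mpol vec set)"
    by (auto simp: enum_vec_def)
  show "(carrier_vec n :: ('n, 'k) mpol vec set) \<subseteq> enum_vec n h ` supported S"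
  proof
    fix v :: "('n, 'k) mpol vec" assume v: "v \<in> carrier_vec n"
    define u where "u b = (if b \<in> S then v $ (inv_into {..<n} h b) else 0)" for b
    have "u (h b) = v $ b" if "b < n" for b
      using that assms by (auto simp: u_def bij_betw_def inv_into_f_f)
    then have "v = enum_vec n h u"
      using v by (intro eq_vecI) (auto simp: enum_vec_def)
    moreover have "u \<in> supported S" by (simp add: supported_def u_def)
    ultimately show "v \<in> enum_vec n h ` supported S" by blast
  qed
qed

lemma enum_vec_eq_iff:
  assumes h: "bij_betw h {..<n} S" and v: "v \<in> supported S" and w: "w \<in> supported S"
  shows "enum_vec n h v = enum_vec n h w \<longleftrightarrow> v = w"
proof
  assume eq: "enum_vec n h v = enum_vec n h w"
  have "v b = w b" for b
  proof (cases "b \<in> S")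
    case True
    then obtain a where "a < n" "b = h a" using h by (auto simp: bij_betw_def)
    then show ?thesis using arg_cong[OF eq, of "\<lambda>u. u $ a"] by (simp add: enum_vec_def)
  qed (use v w in \<open>simp add: supported_def\<close>)
  then show "v = w" by blast
qed simp

lemma enum_vec_0: "enum_vec n h 0 = 0\<^sub>v n"
  by (auto simp: enum_vec_def)

lemma scalar_prod_enum_vec:
  assumes g: "bij_betw g {..<n} T"
  shows "vec n (\<lambda>b. E (g b)) \<bullet> enum_vec n g w = (\<Sum>b\<in>T. E b * w b)"
  using sum.reindex_bij_betw[OF g, of "\<lambda>b. E b * w b"]
  by (simp add: scalar_prod_def enum_vec_def lessThan_atLeast0)

lemma mult_mat_enum_vec:
  assumes h: "bij_betw h {..<n} S" and g: "bij_betw g {..<n'} T"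
  shows "mat n n' (\<lambda>(c, b). M (h c) (g b)) *\<^sub>v enum_vec n' g w = enum_vec n h (app S T M w)"
proof (rule eq_vecI)
  fix c assume "c < dim_vec (enum_vec n h (app S T M w))"
  then have c: "c < n" by (simp add: enum_vec_def)
  then have "h c \<in> S" using h by (auto simp: bij_betw_def)
  have row: "row (mat n n' (\<lambda>(c, b). M (h c) (g b))) c = vec n' (\<lambda>b. M (h c) (g b))"
    using c by (intro eq_vecI) auto
  have "(mat n n' (\<lambda>(c, b). M (h c) (g b)) *\<^sub>v enum_vec n' g w) $ c =
      vec n' (\<lambda>b. M (h c) (g b)) \<bullet> enum_vec n' g w"
    using c by (simp only: index_mult_mat_vec dim_row_mat row)
  also have "\<dots> = app S T M w (h c)"
    using \<open>h c \<in> S\<close> by (simp add: scalar_prod_enum_vec[OF g] app_def)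
  finally show "(mat n n' (\<lambda>(c, b). M (h c) (g b)) *\<^sub>v enum_vec n' g w) $ c =
      enum_vec n h (app S T M w) $ c"
    using c by (simp add: enum_vec_def)
qed (simp add: enum_vec_def)

text \<open>A numbering \<open>h j\<close> of \<open>S j\<close> identifies functions supported on
  \<open>S j\<close> with column vectors of length \<open>r j\<close>, compatibly with the maps.
  Both directions are used: one to leave the matrices of the given resolution, the other to return
  to matrices after truncation.\<close>

lemma multigraded_free_resolution_iff_indexed:
  fixes I :: "('n, 'k::field) mpol set"
  assumes bij: "\<And>j. bij_betw (h j) {..<r j} (S j)"
    and deg: "\<And>j b. b < r j \<Longrightarrow> deg j b = dg j (h j b)"
    and D: "\<And>j. D j = mat (r j) (r (Suc j)) (\<lambda>(c, b). M j (h j c) (h (Suc j) b))"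
    and e: "e = vec (r 0) (\<lambda>b. E (h 0 b))"
  shows "multigraded_free_resolution I r deg D e \<longleftrightarrow> indexed_resolution I S dg M E"
proof -
  have ball: "(\<forall>b\<in>S j. P b) \<longleftrightarrow> (\<forall>b<r j. P (h j b))" for j P
    unfolding bij_betw_imp_surj_on[OF bij[of j], symmetric] by auto
  have ball_vec: "(\<forall>v\<in>carrier_vec (r j). P v) \<longleftrightarrow> (\<forall>v\<in>supported (S j). P (enum_vec (r j) (h j) v))"
    for j and P :: "('n, 'k) mpol vec \<Rightarrow> bool"
    unfolding enum_vec_supported[OF bij[of j], symmetric] by blast
  have bex_vec: "(\<exists>v\<in>carrier_vec (r j). P v) \<longleftrightarrow> (\<exists>v\<in>supported (S j). P (enum_vec (r j) (h j) v))"
    for j and P :: "('n, 'k) mpol vec \<Rightarrow> bool"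
    unfolding enum_vec_supported[OF bij[of j], symmetric] by blast
  have D_app: "D j *\<^sub>v enum_vec (r (Suc j)) (h (Suc j)) w =
      enum_vec (r j) (h j) (app (S j) (S (Suc j)) (M j) w)" for j w
    unfolding D by (rule mult_mat_enum_vec[OF bij bij])
  have e_app: "e \<bullet> enum_vec (r 0) (h 0) v = (\<Sum>b\<in>S 0. E b * v b)" for v
    unfolding e by (rule scalar_prod_enum_vec[OF bij])
  have D_0: "D j *\<^sub>v enum_vec (r (Suc j)) (h (Suc j)) v = 0\<^sub>v (r j) \<longleftrightarrow>
      app (S j) (S (Suc j)) (M j) v = 0" for j v
    unfolding D_app using enum_vec_eq_iff[OF bij supported_app supported_0]
    by (metis enum_vec_0)
  have D_eq: "enum_vec (r j) (h j) v = D j *\<^sub>v enum_vec (r (Suc j)) (h (Suc j)) w \<longleftrightarrow>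
      v = app (S j) (S (Suc j)) (M j) w" if "v \<in> supported (S j)" for j v w
    unfolding D_app by (rule enum_vec_eq_iff[OF bij that supported_app])
  have hom: "(\<forall>c<r j. \<forall>b<r (Suc j). homogeneous (deg (Suc j) b - deg j c) (D j $$ (c, b))) \<longleftrightarrow>
      (\<forall>c\<in>S j. \<forall>b\<in>S (Suc j). homogeneous (dg (Suc j) b - dg j c) (M j c b))" for j
    unfolding ball by (auto simp: D deg)
  have hom_e: "(\<forall>c<r 0. homogeneous (deg 0 c) (e $ c)) \<longleftrightarrow> (\<forall>c\<in>S 0. homogeneous (dg 0 c) (E c))"
    unfolding ball by (auto simp: e deg)
  have carrier: "D j \<in> carrier_mat (r j) (r (Suc j))" "e \<in> carrier_vec (r 0)" for j
    by (simp_all add: D e)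
  have surj: "(\<exists>v\<in>carrier_vec (r 0). f - e \<bullet> v \<in> I) \<longleftrightarrow>
      (\<exists>v\<in>supported (S 0). f - (\<Sum>b\<in>S 0. E b * v b) \<in> I)" for f
    unfolding bex_vec e_app ..
  have aug: "(\<forall>v\<in>carrier_vec (r 0). e \<bullet> v \<in> I \<longleftrightarrow> (\<exists>w\<in>carrier_vec (r 1). v = D 0 *\<^sub>v w)) \<longleftrightarrow>
      (\<forall>v\<in>supported (S 0). (\<Sum>b\<in>S 0. E b * v b) \<in> I \<longleftrightarrow>
        (\<exists>w\<in>supported (S 1). v = app (S 0) (S 1) (M 0) w))"
    unfolding ball_vec bex_vec e_app One_nat_def
    by (intro ball_cong refl arg_cong2[where f = "(=)"] bex_cong D_eq)
  have exact: "(\<forall>v\<in>carrier_vec (r (Suc j)). D j *\<^sub>v v = 0\<^sub>v (r j) \<longleftrightarrow>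
        (\<exists>w\<in>carrier_vec (r (Suc (Suc j))). v = D (Suc j) *\<^sub>v w)) \<longleftrightarrow>
      (\<forall>v\<in>supported (S (Suc j)). app (S j) (S (Suc j)) (M j) v = 0 \<longleftrightarrow>
        (\<exists>w\<in>supported (S (Suc (Suc j))). v = app (S (Suc j)) (S (Suc (Suc j))) (M (Suc j)) w))" for j
    unfolding ball_vec bex_vec D_0
    by (intro ball_cong refl arg_cong2[where f = "(=)"] bex_cong D_eq)
  show ?thesis
    by (simp only: multigraded_free_resolution_def indexed_resolution_def carrier hom hom_e
      surj aug exact simp_thms)
qed

lemma homogeneous_pure_degree: "homogeneous d p \<Longrightarrow> pure_degree i (d i) p"
  by (auto simp: homogeneous_def pure_degree_def multidegree_def)

text \<open>The exactness conditions are instances of \<open>exact_below\<close>: at R/I with all of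
  R as K and I as N; in homological degree 0 and in positive degrees with the kernel as K and
  \<open>{0}\<close> as N.\<close>

lemma indexed_resolution_below:
  fixes I J :: "('n, 'k::field) mpol set"
  assumes res: "indexed_resolution I S dg M E" and fin: "\<And>j. finite (S j)"
    and IJ: "compatible i c (\<lambda>_. 0) {v. v 0 \<in> I} {v. v 0 \<in> J}" and c: "0 < c"
  shows "indexed_resolution J (\<lambda>j. below (\<lambda>b. dg j b i) c (S j)) dg M E"
proof -
  define di where "di j b = dg j b i" for j b
  define S' where "S' j = below (di j) c (S j)" for j
  have sub: "S' j \<subseteq> S j" for j by (auto simp: S'_def below_def)
  have hM: "hom_matrix i (S j) (di j) (S (Suc j)) (di (Suc j)) (M j)" for j
    using res homogeneous_pure_degree[of "dg (Suc j) b - dg j c" "M j c b" i for b c]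
    by (simp add: indexed_resolution_def hom_matrix_def di_def)
  have hE: "hom_matrix i {0} (\<lambda>_. 0) (S 0) (di 0) (\<lambda>_. E)"
    using res homogeneous_pure_degree[of "dg 0 b" "E b" i for b]
    by (simp add: indexed_resolution_def hom_matrix_def di_def)
  have E_app: "app {0} (S 0) (\<lambda>_. E) v 0 = (\<Sum>b\<in>S 0. E b * v b)" for v
    by (simp add: app_def)
  have E_below: "(\<Sum>b\<in>S' 0. E b * v b) = (\<Sum>b\<in>S 0. E b * v b)" if "v \<in> supported (S' 0)" for v
    using that sub fin by (intro sum.mono_neutral_left) (auto simp: supported_def)
  have M_below: "app (S' j) (S' (Suc j)) (M j) w = app (S j) (S (Suc j)) (M j) w"
    if "w \<in> supported (S' (Suc j))" for j w
    using app_below[OF hM _ fin] that by (simp add: S'_def)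
  let ?KI = "{v. v 0 \<in> I}" and ?KJ = "{v. v 0 \<in> J}"
  \<comment> \<open>The basis element of R itself survives the truncation because its degree 0 is
    less than c.\<close>
  have *: "below (\<lambda>_. 0) c {0} = {0}" using c by (auto simp: below_def)
  have aug: "\<exists>v\<in>supported (S' 0). f - (\<Sum>b\<in>S' 0. E b * v b) \<in> J" for f
  proof -
    define u where "u b = (if b = (0::nat) then f else 0)" for b
    have "\<exists>w\<in>supported (S 0). v - app {0} (S 0) (\<lambda>_. E) w \<in> ?KI" for v
      using res by (simp add: indexed_resolution_def E_app)
    then have "\<exists>w\<in>supported (S' 0). u - app {0} (S 0) (\<lambda>_. E) w \<in> ?KJ"
      using exact_below[OF _ hE compatible_UNIV IJ, of u]
      by (simp add: S'_def * supported_def u_def)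
    then show ?thesis by (auto simp: E_app u_def E_below)
  qed
  have diff_0: "v - u \<in> {0} \<longleftrightarrow> v = u" for u v :: "nat \<Rightarrow> ('n, 'k) mpol"
    by simp
  have exact_aug: "(\<Sum>b\<in>S' 0. E b * v b) \<in> J \<longleftrightarrow>
      (\<exists>w\<in>supported (S' 1). v = app (S' 0) (S' 1) (M 0) w)" if v: "v \<in> supported (S' 0)" for v
  proof -
    let ?K = "{v \<in> supported (S 0). app {0} (S 0) (\<lambda>_. E) v \<in> ?KI}"
    let ?K' = "{v \<in> supported (S' 0). app {0} (S 0) (\<lambda>_. E) v \<in> ?KJ}"
    have K: "compatible i c (di 0) ?K ?K'"
      using compatible_vimage[OF hE IJ] by (simp add: S'_def)
    have "u \<in> ?K \<longleftrightarrow> (\<exists>w\<in>supported (S 1). u - app (S 0) (S 1) (M 0) w \<in> {0})"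
      if "u \<in> supported (S 0)" for u
      using res that unfolding diff_0 by (simp add: indexed_resolution_def E_app)
    then have "v \<in> ?K' \<longleftrightarrow> (\<exists>w\<in>supported (S' 1). v - app (S 0) (S 1) (M 0) w \<in> {0})"
      using exact_below[OF fin hM K compatible_zero] v unfolding S'_def One_nat_def by blast
    then show ?thesis
      unfolding diff_0 using v M_below[of _ 0] E_below by (simp add: E_app cong: bex_cong)
  qed
  have exact: "app (S' j) (S' (Suc j)) (M j) v = 0 \<longleftrightarrow>
      (\<exists>w\<in>supported (S' (Suc (Suc j))). v = app (S' (Suc j)) (S' (Suc (Suc j))) (M (Suc j)) w)"
    if v: "v \<in> supported (S' (Suc j))" for j v
  proof -
    let ?A = "app (S j) (S (Suc j)) (M j)"
    let ?B = "app (S (Suc j)) (S (Suc (Suc j))) (M (Suc j))"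
    let ?K = "{v \<in> supported (S (Suc j)). ?A v \<in> {0}}"
    let ?K' = "{v \<in> supported (S' (Suc j)). ?A v \<in> {0}}"
    have K: "compatible i c (di (Suc j)) ?K ?K'"
      using compatible_vimage[OF hM compatible_zero] by (simp add: S'_def)
    have "u \<in> ?K \<longleftrightarrow> (\<exists>w\<in>supported (S (Suc (Suc j))). u - ?B w \<in> {0})"
      if "u \<in> supported (S (Suc j))" for u
      using res that unfolding diff_0 by (simp add: indexed_resolution_def)
    then have "v \<in> ?K' \<longleftrightarrow> (\<exists>w\<in>supported (S' (Suc (Suc j))). v - ?B w \<in> {0})"
      using exact_below[OF fin hM K compatible_zero] v unfolding S'_def by blast
    then show ?thesis
      unfolding diff_0 using v M_below by (simp cong: bex_cong)
  qed
  have "indexed_resolution J S' dg M E"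
    unfolding indexed_resolution_def
  proof (intro conjI allI ballI)
    show "homogeneous (dg (Suc j) b - dg j a) (M j a b)" if "a \<in> S' j" "b \<in> S' (Suc j)" for j a b
      using that res sub by (simp add: indexed_resolution_def subset_iff)
    show "homogeneous (dg 0 a) (E a)" if "a \<in> S' 0" for a
      using that res sub by (simp add: indexed_resolution_def subset_iff)
  qed (fact aug exact_aug exact)+
  moreover have "S' = (\<lambda>j. below (\<lambda>b. dg j b i) c (S j))"
    by (simp add: S'_def di_def below_def fun_eq_iff)
  ultimately show ?thesis by simp
qed

text \<open>Truncating a minimal resolution keeps it minimal, since the remaining matrix entries are
  among the old ones; the surviving basis elements are those whose multidegree is less than c at
  i.\<close>

lemma multigraded_betti_numbers_below:
  fixes I J :: "('n, 'k::field) mpol set"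
  assumes betti: "multigraded_betti_numbers I \<beta>"
    and IJ: "compatible i c (\<lambda>_. 0) {v. v 0 \<in> I} {v. v 0 \<in> J}" and c: "0 < c"
  shows "multigraded_betti_numbers J (\<lambda>j \<alpha>. if \<alpha> i < c then \<beta> j \<alpha> else 0)"
proof -
  obtain r deg D e where res: "multigraded_free_resolution I r deg D e"
    and min: "\<And>j c b. c < r j \<Longrightarrow> b < r (Suc j) \<Longrightarrow> D j $$ (c, b) \<in> max_ideal"
    and \<beta>: "\<And>j \<alpha>. \<beta> j \<alpha> = card {b. b < r j \<and> deg j b = \<alpha>}"
    using betti
    unfolding multigraded_betti_numbers_def minimal_multigraded_free_resolution_def by blast
  define S where "S j = below (\<lambda>b. deg j b i) c {..<r j}" for j
  define M where "M j a b = D j $$ (a, b)" for j a b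
  define E where "E b = e $ b" for b
  have fin: "finite (S j)" for j by (simp add: S_def below_def)
  have "indexed_resolution I (\<lambda>j. {..<r j}) deg M E"
  proof (rule multigraded_free_resolution_iff_indexed[THEN iffD1, OF _ _ _ _ res])
    show "bij_betw (\<lambda>b. b) {..<r j} {..<r j}" for j by (simp add: bij_betw_def)
    show "D j = mat (r j) (r (Suc j)) (\<lambda>(c, b). M j c b)" for j
      using res by (intro eq_matI) (auto simp: multigraded_free_resolution_def M_def)
    show "e = vec (r 0) (\<lambda>b. E b)"
      using res by (intro eq_vecI) (auto simp: multigraded_free_resolution_def E_def)
  qed simp
  then have ind: "indexed_resolution J S deg M E"
    unfolding S_def by (rule indexed_resolution_below) (simp_all add: IJ c)
  have "\<exists>h. bij_betw h {..<card (S j)} (S j)" for j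
    using ex_bij_betw_nat_finite[OF fin] by (simp add: lessThan_atLeast0)
  then obtain h where h: "\<And>j. bij_betw (h j) {..<card (S j)} (S j)" by metis
  have h_less: "h j b < r j" if "b < card (S j)" for j b
    using h[of j] that by (auto simp: bij_betw_def S_def below_def)
  define r' where "r' j = card (S j)" for j
  define deg' where "deg' j b = deg j (h j b)" for j b
  define D' where "D' j = mat (r' j) (r' (Suc j)) (\<lambda>(c, b). M j (h j c) (h (Suc j) b))" for j
  define e' where "e' = vec (r' 0) (\<lambda>b. E (h 0 b))"
  have "multigraded_free_resolution J r' deg' D' e'"
    by (rule multigraded_free_resolution_iff_indexed[THEN iffD2, OF _ _ _ _ ind])
      (simp_all add: r'_def deg'_def D'_def e'_def h)
  moreover have "D' j $$ (c, b) \<in> max_ideal" if "c < r' j" "b < r' (Suc j)" for j c b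
    using that min h_less by (simp add: D'_def M_def r'_def)
  moreover have "(if \<alpha> i < c then \<beta> j \<alpha> else 0) = card {b. b < r' j \<and> deg' j b = \<alpha>}" for j \<alpha>
  proof -
    have "bij_betw (h j) {b. b < r' j \<and> deg' j b = \<alpha>} {b \<in> S j. deg j b = \<alpha>}"
      using h[of j] by (auto simp: bij_betw_def inj_on_def r'_def deg'_def)
    then have "card {b. b < r' j \<and> deg' j b = \<alpha>} = card {b \<in> S j. deg j b = \<alpha>}"
      by (rule bij_betw_same_card)
    also have "{b \<in> S j. deg j b = \<alpha>} = (if \<alpha> i < c then {b. b < r j \<and> deg j b = \<alpha>} else {})"
      by (auto simp: S_def below_def)
    finally show ?thesis by (simp add: \<beta>)
  qed
  ultimately show ?thesis
    unfolding multigraded_betti_numbers_def minimal_multigraded_free_resolution_def by blast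
qed

subsection \<open>Deleting a generator from the pruning\<close>

definition unmatched :: "'n expo list \<Rightarrow> nat \<Rightarrow> nat set \<Rightarrow> bool" where
  "unmatched ms k \<sigma> \<longleftrightarrow> (\<forall>(\<tau>, \<tau>') \<in> pruned_edges ms k. \<sigma> \<notin> {\<tau>, \<tau>'})"

lemma unmatched_0 [simp]: "unmatched ms 0 \<sigma>"
  by (simp add: unmatched_def)

text \<open>The only edge through \<sigma> that step k can select joins \<sigma> - {k} and \<sigma>
  \<union> {k}, so the fate of \<sigma> in this step is decided by these two faces.\<close>

lemma unmatched_Suc:
  assumes \<sigma>: "\<sigma> \<subseteq> {..<length ms}" and k: "k < length ms"
  shows "unmatched ms (Suc k) \<sigma> \<longleftrightarrow> unmatched ms k \<sigma> \<and>
    \<not> (lcm_face ms (\<sigma> - {k}) = lcm_face ms (insert k \<sigma>) \<and>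
       unmatched ms k (\<sigma> - {k}) \<and> unmatched ms k (insert k \<sigma>))"
proof -
  define new where "new \<tau> \<longleftrightarrow> \<tau> \<subseteq> {..<length ms} \<and> k \<notin> \<tau> \<and>
    lcm_face ms \<tau> = lcm_face ms (insert k \<tau>) \<and> unmatched ms k \<tau> \<and> unmatched ms k (insert k \<tau>)"
    for \<tau>
  have edges: "pruned_edges ms (Suc k) = pruned_edges ms k \<union> {(\<tau>, insert k \<tau>) | \<tau>. new \<tau>}"
  proof -
    have "(\<forall>(\<rho>, \<rho>')\<in>pruned_edges ms k. \<tau> \<notin> {\<rho>, \<rho>'} \<and> insert k \<tau> \<notin> {\<rho>, \<rho>'}) \<longleftrightarrow>
        unmatched ms k \<tau> \<and> unmatched ms k (insert k \<tau>)" for \<tau>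
      unfolding unmatched_def by blast
    then show ?thesis by (simp only: pruned_edges.simps new_def)
  qed
  have "unmatched ms (Suc k) \<sigma> \<longleftrightarrow>
      unmatched ms k \<sigma> \<and> (\<forall>\<tau>. new \<tau> \<longrightarrow> \<sigma> \<noteq> \<tau> \<and> \<sigma> \<noteq> insert k \<tau>)"
    unfolding unmatched_def edges by blast
  also have "(\<forall>\<tau>. new \<tau> \<longrightarrow> \<sigma> \<noteq> \<tau> \<and> \<sigma> \<noteq> insert k \<tau>) \<longleftrightarrow> \<not> new (\<sigma> - {k})"
  proof
    assume *: "\<forall>\<tau>. new \<tau> \<longrightarrow> \<sigma> \<noteq> \<tau> \<and> \<sigma> \<noteq> insert k \<tau>"
    show "\<not> new (\<sigma> - {k})"
      using *[rule_format, of "\<sigma> - {k}"] by (cases "k \<in> \<sigma>") (auto simp: insert_absorb)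
  next
    assume *: "\<not> new (\<sigma> - {k})"
    have "\<sigma> - {k} = \<tau>" if "new \<tau>" "\<sigma> = \<tau> \<or> \<sigma> = insert k \<tau>" for \<tau>
      using that by (auto simp: new_def)
    then show "\<forall>\<tau>. new \<tau> \<longrightarrow> \<sigma> \<noteq> \<tau> \<and> \<sigma> \<noteq> insert k \<tau>"
      using * by metis
  qed
  also have "new (\<sigma> - {k}) \<longleftrightarrow> lcm_face ms (\<sigma> - {k}) = lcm_face ms (insert k \<sigma>) \<and>
       unmatched ms k (\<sigma> - {k}) \<and> unmatched ms k (insert k \<sigma>)"
    using \<sigma> by (auto simp: new_def)
  finally show ?thesis .
qed

lemma critical_faces_eq_unmatched:
  "critical_faces ms = {\<sigma>. \<sigma> \<subseteq> {..<length ms} \<and> unmatched ms (length ms) \<sigma>}"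
  by (simp add: critical_faces_def unmatched_def)

text \<open>Position j after deletion of entry p is position \<open>skip p j\<close> of the original
  list. The same map translates vertices and numbers of steps.\<close>

definition skip :: "nat \<Rightarrow> nat \<Rightarrow> nat" where
  "skip p j = (if j < p then j else Suc j)"

lemma inj_skip: "inj (skip p)"
  by (auto simp: inj_def skip_def split: if_splits)

lemma skip_neq [simp]: "skip p j \<noteq> p"
  "p \<noteq> skip p j"
  by (simp_all add: skip_def)

lemma skip_image: "\<tau> \<subseteq> {..<Suc n} \<Longrightarrow> p \<notin> \<tau> \<Longrightarrow> p \<le> n \<Longrightarrow> \<exists>\<sigma>\<subseteq>{..<n}. \<tau> = skip p ` \<sigma>"
proof -
  assume \<tau>: "\<tau> \<subseteq> {..<Suc n}" "p \<notin> \<tau>" and p: "p \<le> n"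
  have "\<tau> \<subseteq> skip p ` {..<n}"
  proof
    fix j assume "j \<in> \<tau>"
    then have "j < Suc n" "j \<noteq> p" using \<tau> by auto
    then have "j = skip p (if j < p then j else j - 1)" "(if j < p then j else j - 1) < n"
      using p by (auto simp: skip_def)
    then show "j \<in> skip p ` {..<n}" by blast
  qed
  then show ?thesis by (metis subset_image_iff)
qed

definition delete_nth :: "nat \<Rightarrow> 'a list \<Rightarrow> 'a list" where
  "delete_nth p xs = take p xs @ drop (Suc p) xs"

lemma length_delete_nth: "p < length xs \<Longrightarrow> Suc (length (delete_nth p xs)) = length xs"
  by (simp add: delete_nth_def)

lemma nth_delete_nth:
  "p < length xs \<Longrightarrow> j < length (delete_nth p xs) \<Longrightarrow> delete_nth p xs ! j = xs ! skip p j"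
  by (auto simp: delete_nth_def nth_append skip_def min_def)

lemma lcm_face_delete_nth:
  assumes "p < length ms" "\<sigma> \<subseteq> {..<length (delete_nth p ms)}"
  shows "lcm_face (delete_nth p ms) \<sigma> = lcm_face ms (skip p ` \<sigma>)"
proof -
  have "(\<lambda>j. (delete_nth p ms ! j) i) ` \<sigma> = (\<lambda>j. (ms ! j) i) ` skip p ` \<sigma>" for i
    unfolding image_image using assms by (intro image_cong) (auto simp: nth_delete_nth subset_iff)
  then show ?thesis by (simp add: lcm_face_def)
qed

context
  fixes ms :: "'n expo list" and p :: nat and i :: 'n
  assumes p: "p < length ms" and dom: "\<And>j. j < length ms \<Longrightarrow> j \<noteq> p \<Longrightarrow> (ms ! j) i < (ms ! p) i"
begin

text \<open>All other generators have a smaller exponent in variable i, so the maximum reaches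
  \<open>(ms ! p) i\<close> exactly when p is in the face. Positivity is for the default 0 in
  \<open>lcm_face\<close>, which has to stay below.\<close>

lemma lcm_face_less_iff:
  assumes "\<sigma> \<subseteq> {..<length ms}" "0 < (ms ! p) i"
  shows "lcm_face ms \<sigma> i < (ms ! p) i \<longleftrightarrow> p \<notin> \<sigma>"
proof -
  have "finite \<sigma>" using assms(1) finite_subset by blast
  then have "lcm_face ms \<sigma> i < (ms ! p) i \<longleftrightarrow> (\<forall>j\<in>\<sigma>. (ms ! j) i < (ms ! p) i)"
    using assms(2) by (simp add: lcm_face_def)
  then show ?thesis using assms(1) dom by blast
qed

text \<open>Step \<open>p\<close> selects no edge, since adding \<open>p\<close> to a face raises the exponent of \<open>i\<close>.\<close>

lemma unmatched_delete_nth: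
  assumes pos: "0 < (ms ! p) i" and k: "k \<le> length (delete_nth p ms)"
    and \<sigma>: "\<sigma> \<subseteq> {..<length (delete_nth p ms)}"
  shows "unmatched (delete_nth p ms) k \<sigma> \<longleftrightarrow> unmatched ms (skip p k) (skip p ` \<sigma>)"
  using k \<sigma>
proof (induction k arbitrary: \<sigma>)
  have len: "Suc (length (delete_nth p ms)) = length ms" using p by (rule length_delete_nth)
  have face: "skip p ` \<sigma> \<subseteq> {..<length ms}" if "\<sigma> \<subseteq> {..<length (delete_nth p ms)}" for \<sigma>
    using that len by (force simp: skip_def)
  have step_p: "unmatched ms (Suc p) \<tau> \<longleftrightarrow> unmatched ms p \<tau>" if "\<tau> \<subseteq> {..<length ms}" for \<tau>
  proof -
    have "lcm_face ms (\<tau> - {p}) i < (ms ! p) i" "\<not> lcm_face ms (insert p \<tau>) i < (ms ! p) i"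
      using that p pos by (auto simp: lcm_face_less_iff subset_iff)
    then have "lcm_face ms (\<tau> - {p}) \<noteq> lcm_face ms (insert p \<tau>)" by metis
    then show ?thesis using unmatched_Suc[OF that p] by blast
  qed
  {
    case 0
    show ?case
    proof (cases "p = 0")
      case True
      \<comment> \<open>Zero steps for the shorter list correspond here to one step for the full
        list, namely step p = 0, which selects nothing.\<close>
      then have "skip p 0 = Suc p" by (simp add: skip_def)
      then show ?thesis using step_p[OF face[OF 0(2)]] True by simp
    next
      case False
      then have "skip p 0 = 0" by (simp add: skip_def)
      then show ?thesis by simp
    qed
  next
    case (Suc k)
    let ?ms = "delete_nth p ms"
    have k: "k < length ?ms" using Suc.prems by simp
    then have k': "skip p k < length ms" using len by (simp add: skip_def)
    have sub: "\<sigma> - {k} \<subseteq> {..<length ?ms}" "insert k \<sigma> \<subseteq> {..<length ?ms}"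
      using Suc.prems k by auto
    have img: "skip p ` (\<sigma> - {k}) = skip p ` \<sigma> - {skip p k}"
      "skip p ` insert k \<sigma> = insert (skip p k) (skip p ` \<sigma>)"
      using image_set_diff[OF inj_skip, of p \<sigma> "{k}"] by auto
    \<comment> \<open>Step k for the shorter list compares the same two lcms as step
      \<open>skip p k\<close> for the full list, and the induction hypothesis covers both faces of
      the candidate edge.\<close>
    have "unmatched ?ms (Suc k) \<sigma> \<longleftrightarrow> unmatched ms (Suc (skip p k)) (skip p ` \<sigma>)"
      using Suc.IH[OF _ Suc.prems(2)] Suc.IH[OF _ sub(1)] Suc.IH[OF _ sub(2)] Suc.prems(1)
      by (simp add: unmatched_Suc[OF Suc.prems(2) k] unmatched_Suc[OF face[OF Suc.prems(2)] k']
          lcm_face_delete_nth[OF p sub(1)] lcm_face_delete_nth[OF p sub(2)] img)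
    \<comment> \<open>The two step counts differ only if Suc k = p; then the right-hand side also
      includes the idle step p.\<close>
    also have "\<dots> \<longleftrightarrow> unmatched ms (skip p (Suc k)) (skip p ` \<sigma>)"
      using step_p[OF face[OF Suc.prems(2)]] by (auto simp: skip_def not_less_eq less_Suc_eq)
    finally show ?case .
  }
qed

text \<open>\<open>skip p\<close> carries the critical faces of the shorter list onto the critical
  faces of the full list that avoid p, preserving size and lcm; by \<open>lcm_face_less_iff\<close>
  these are the ones of small degree in i.\<close>

lemma pruned_rank_delete_nth:
  assumes pos: "0 < (ms ! p) i"
  shows "pruned_rank (delete_nth p ms) j \<alpha> =
    (if \<alpha> i < int ((ms ! p) i) then pruned_rank ms j \<alpha> else 0)"
proof -
  let ?ms = "delete_nth p ms"
  let ?A = "{\<sigma> \<in> critical_faces ?ms. card \<sigma> = j \<and> multidegree (lcm_face ?ms \<sigma>) = \<alpha>}"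
  let ?B = "{\<sigma> \<in> critical_faces ms. p \<notin> \<sigma> \<and> card \<sigma> = j \<and> multidegree (lcm_face ms \<sigma>) = \<alpha>}"
  have len: "Suc (length ?ms) = length ms" using p by (rule length_delete_nth)
  have skip_len: "skip p (length ?ms) = length ms" using len p by (simp add: skip_def)
  have crit: "\<sigma> \<in> critical_faces ?ms \<longleftrightarrow> skip p ` \<sigma> \<in> critical_faces ms"
    if "\<sigma> \<subseteq> {..<length ?ms}" for \<sigma>
  proof -
    have "skip p ` \<sigma> \<subseteq> {..<length ms}" using that len by (force simp: skip_def)
    then show ?thesis
      using unmatched_delete_nth[OF pos order.refl that] that
      by (simp add: critical_faces_eq_unmatched skip_len)
  qed
  have sub: "\<sigma> \<subseteq> {..<length ms'}" if "\<sigma> \<in> critical_faces ms'" for \<sigma> and ms' :: "'n expo list"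
    using that by (simp add: critical_faces_def)
  have card: "card (skip p ` \<sigma>) = card \<sigma>" for \<sigma>
    by (intro card_image inj_on_subset[OF inj_skip]) simp
  have "image (skip p) ` ?A = ?B"
  proof
    show "image (skip p) ` ?A \<subseteq> ?B"
      using crit sub by (auto simp: card lcm_face_delete_nth[OF p])
    show "?B \<subseteq> image (skip p) ` ?A"
    proof
      fix \<tau> assume \<tau>: "\<tau> \<in> ?B"
      then obtain \<sigma> where "\<sigma> \<subseteq> {..<length ?ms}" "\<tau> = skip p ` \<sigma>"
        using skip_image[of \<tau> "length ?ms" p] sub[of \<tau> ms] len p by auto
      then show "\<tau> \<in> image (skip p) ` ?A"
        using \<tau> crit by (auto simp: card lcm_face_delete_nth[OF p])
    qed
  qed
  moreover have "inj_on (image (skip p)) ?A"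
    using inj_skip[of p] by (auto simp: inj_on_def inj_image_eq_iff)
  ultimately have "card ?A = card ?B"
    using card_image[of "image (skip p)" ?A] by (simp only:)
  moreover have "?B = (if \<alpha> i < int ((ms ! p) i) then
      {\<sigma> \<in> critical_faces ms. card \<sigma> = j \<and> multidegree (lcm_face ms \<sigma>) = \<alpha>} else {})"
    using lcm_face_less_iff[OF sub pos] by (auto simp: multidegree_def)
  ultimately show ?thesis by (simp add: pruned_rank_def)
qed

end

section \<open>The remaining generators, the zero ideal, and the combination of both
  restrictions\<close>

lemma set_delete_nth:
  assumes "distinct xs" "p < length xs"
  shows "set (delete_nth p xs) = set xs - {xs ! p}"
proof -
  have "xs = take p xs @ xs ! p # drop (Suc p) xs" using assms(2) by (rule id_take_nth_drop)
  then show ?thesis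
    unfolding delete_nth_def using assms(1)
    by (metis Diff_insert_absorb Un_iff append_Cons distinct.simps(2) distinct_append
        list.simps(15) set_append Un_insert_right disjoint_iff list.set_intros(1))
qed

lemma distinct_delete_nth: "distinct xs \<Longrightarrow> distinct (delete_nth p xs)"
  using set_take_disj_set_drop_if_distinct[of xs p "Suc p"] by (auto simp: delete_nth_def)

text \<open>The resolution has R in homological degree 0 and nothing else, matching the simplex
  without vertices, whose only face is the empty one and is critical.\<close>

lemma admits_minimal_pruned_resolution_zero:
  "admits_minimal_pruned_resolution (monomial_ideal {} :: ('n, 'k::field) mpol set)"
proof -
  have zero: "f \<in> monomial_ideal {} \<longleftrightarrow> f = 0" for f :: "('n, 'k) mpol"
    by (simp add: mem_monomial_ideal_iff)
  define r where "r j = (if j = 0 then 1 else 0 :: nat)" for j :: nat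
  define D :: "nat \<Rightarrow> ('n, 'k) mpol mat" where "D j = 0\<^sub>m (r j) (r (Suc j))" for j
  define e :: "('n, 'k) mpol vec" where "e = vec 1 (\<lambda>_. 1)"
  have e: "e \<bullet> v = v $ 0" if "v \<in> carrier_vec 1" for v
    using that by (simp add: e_def scalar_prod_def)
  have D0: "D 0 *\<^sub>v w = 0\<^sub>v 1" if "w \<in> carrier_vec 0" for w
    using that by (intro eq_vecI) (auto simp: D_def r_def scalar_prod_def)
  have "minimal_multigraded_free_resolution (monomial_ideal {}) r (\<lambda>_ _ _. 0) D e"
    unfolding minimal_multigraded_free_resolution_def multigraded_free_resolution_def
  proof (intro conjI allI impI ballI)
    show "\<exists>v\<in>carrier_vec (r 0). f - e \<bullet> v \<in> monomial_ideal {}" for f :: "('n, 'k) mpol"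
      by (intro bexI[of _ "vec 1 (\<lambda>_. f)"]) (auto simp: zero e r_def)
    show "e \<bullet> v \<in> monomial_ideal {} \<longleftrightarrow> (\<exists>w\<in>carrier_vec (r 1). v = D 0 *\<^sub>v w)"
      if "v \<in> carrier_vec (r 0)" for v
    proof -
      have v: "v \<in> carrier_vec 1" using that by (simp add: r_def)
      have "e \<bullet> v \<in> monomial_ideal {} \<longleftrightarrow> v = 0\<^sub>v 1"
        using v by (auto simp: zero e intro: eq_vecI)
      also have "\<dots> \<longleftrightarrow> (\<exists>w\<in>carrier_vec 0. v = D 0 *\<^sub>v w)"
        using D0 zero_carrier_vec by metis
      finally show ?thesis by (simp add: r_def)
    qed
    show "D j *\<^sub>v v = 0\<^sub>v (r j) \<longleftrightarrow> (\<exists>w\<in>carrier_vec (r (Suc (Suc j))). v = D (Suc j) *\<^sub>v w)"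
      if "v \<in> carrier_vec (r (Suc j))" for j v
    proof -
      have "v = 0\<^sub>v 0" using that by (intro eq_vecI) (simp_all add: r_def)
      then show ?thesis
        by (auto simp: D_def r_def scalar_prod_def intro!: eq_vecI bexI[of _ "0\<^sub>v 0"])
    qed
  qed (auto simp: D_def e_def r_def homogeneous_def multidegree_def fun_eq_iff)
  moreover have "pruned_rank [] j \<alpha> = card {b. b < r j \<and> (\<lambda>_. 0) = \<alpha>}" for j and \<alpha> :: "'n \<Rightarrow> int"
  proof -
    have "{\<sigma> \<in> critical_faces ([] :: 'n expo list). card \<sigma> = j \<and> multidegree (lcm_face [] \<sigma>) = \<alpha>} =
        (if j = 0 \<and> (\<lambda>_. 0) = \<alpha> then {{}} else {})"
      by (auto simp: critical_faces_def multidegree_def lcm_face_def)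
    moreover have "{b. b < r j \<and> (\<lambda>_. 0) = \<alpha>} = (if j = 0 \<and> (\<lambda>_. 0) = \<alpha> then {0} else {})"
      by (auto simp: r_def)
    ultimately show ?thesis by (simp add: pruned_rank_def)
  qed
  ultimately have "multigraded_betti_numbers (monomial_ideal {} :: ('n, 'k) mpol set) (pruned_rank [])"
    unfolding multigraded_betti_numbers_def by blast
  moreover have "set [] = minimal_generators (monomial_ideal {} :: ('n, 'k) mpol set)"
    by (simp add: minimal_generators_monomial_ideal)
  ultimately show ?thesis
    unfolding admits_minimal_pruned_resolution_def by (intro exI[of _ "[]"]) simp
qed

theorem corollary3p10:
  fixes m :: "nat \<Rightarrow> ('n::finite \<Rightarrow> nat)"
    and q :: nat
    and I J :: "(('n \<Rightarrow> nat) \<Rightarrow>\<^sub>0 'k::field) set"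
  assumes "q \<ge> 1"
    and "I = monomial_ideal (m ` {1..q})"
    and "bij_betw m {1..q} (minimal_generators I)"
    and "J = monomial_ideal (m ` {1..<q})"
    and "admits_minimal_pruned_resolution I"
    and "\<forall>i. (\<forall>j \<in> {1..<q}. m q i > m j i) \<or> m q i = 0"
  shows "admits_minimal_pruned_resolution J"
proof -
  let ?G = "m ` {1..q}" and ?H = "m ` {1..<q}"
  have gens: "minimal_generators I = ?G"
    using assms(3) by (simp add: bij_betw_def)
  then have anti: "a = b" if "a \<in> ?G" "b \<in> ?G" "a \<le> b" for a b
    using that unfolding assms(2) minimal_generators_monomial_ideal by blast
  have "{1..q} = insert q {1..<q}" using assms(1) by auto
  then have G: "?G = insert (m q) ?H" by simp
  have "m q \<notin> ?H"
  proof
    assume "m q \<in> ?H"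
    then obtain j where "j \<in> {1..<q}" "m q = m j" by blast
    then show False
      using inj_onD[OF bij_betw_imp_inj_on[OF assms(3)], of q j] assms(1) by simp
  qed
  show ?thesis
  proof (cases "\<exists>i. 0 < m q i")
    case False
    \<comment> \<open>Here \<open>m q\<close> is the monomial 1, which divides every other
      generator; by minimality there is no other.\<close>
    then have "m q \<le> b" for b by (simp add: le_fun_def)
    then have "m q = b" if "b \<in> ?H" for b
      using anti[of "m q" b] that unfolding G by blast
    then have "?H = {}" using \<open>m q \<notin> ?H\<close> by blast
    then show ?thesis using admits_minimal_pruned_resolution_zero assms(4) by simp
  next
    case True
    then obtain i where i: "0 < m q i" by blast
    then have less: "b i < m q i" if b: "b \<in> ?H" for b
    proof -
      obtain j where "j \<in> {1..<q}" "b = m j" using b by blast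
      then show ?thesis using assms(6) i by (metis less_numeral_extra(3))
    qed
    have "b = a" if "a \<in> ?H" "b \<in> ?H" "b \<le> a" for a b
      using anti[of b a] that unfolding G by blast
    then have gens_J: "minimal_generators J = ?H"
      unfolding assms(4) minimal_generators_monomial_ideal by blast
    obtain ms where ms: "distinct ms" "set ms = ?G" "multigraded_betti_numbers I (pruned_rank ms)"
      using assms(5) gens unfolding admits_minimal_pruned_resolution_def by metis
    \<comment> \<open>The good order for I may have \<open>m q\<close> at any position p; the order
      for J arises by deleting it there.\<close>
    then obtain p where p: "p < length ms" "ms ! p = m q"
      using G by (metis in_set_conv_nth insertI1)
    have set: "set (delete_nth p ms) = ?H"
      using set_delete_nth[OF ms(1) p(1)] ms(2) p(2) G \<open>m q \<notin> ?H\<close> by simp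
    have dom: "(ms ! j) i < (ms ! p) i" if "j < length ms" "j \<noteq> p" for j
    proof -
      have "ms ! j \<noteq> m q" using that p ms(1) by (metis nth_eq_iff_index_eq)
      then show ?thesis using less that p ms(2) G by (metis insertE nth_mem)
    qed
    have "compatible i (int (m q i)) (\<lambda>_. 0) {v. v 0 \<in> I} {v. v 0 \<in> J}"
    proof (rule compatible_ideal[OF assms(2,4)])
      fix a :: "'n expo" assume "int (a i) < int (m q i)"
      then have "\<not> m q \<le> a" by (auto simp: le_fun_def not_le)
      then show "(\<exists>b\<in>?G. b \<le> a) \<longleftrightarrow> (\<exists>b\<in>?H. b \<le> a)" unfolding G by blast
    qed (use less in simp)
    then have "multigraded_betti_numbers J
        (\<lambda>j \<alpha>. if \<alpha> i < int (m q i) then pruned_rank ms j \<alpha> else 0)"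
      using multigraded_betti_numbers_below[OF ms(3)] i by simp
    also have "(\<lambda>j \<alpha>. if \<alpha> i < int (m q i) then pruned_rank ms j \<alpha> else 0) =
        pruned_rank (delete_nth p ms)"
      using pruned_rank_delete_nth[where i = i, OF p(1) dom] i p(2) by (simp add: fun_eq_iff)
    finally show ?thesis
      unfolding admits_minimal_pruned_resolution_def
      using distinct_delete_nth[OF ms(1)] set gens_J by blast
  qed
qed

end
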